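(* Let $n\ge 2$ be an integer, and let $p$ and $x$ be propositional variables. (1) The logic $\mathbf{L}_1=\mathbf{K}_n+(\square p\vee\square\neg p)$ is $n+1$-Kripke complete with respect to the class of the $n+1$-frames $\langle W,\{r_m\mid m\in\mathrm{div}(n)\},R\rangle$ that satisfy $Ru\subseteq r_1$ for all $u\in W$, but $\mathbf{L}_1$ is not Kripke complete. (2) The logic $\mathbf{L}_2=\mathbf{K}_n+\square(p\vee\neg p)+\square\square p+\neg(\lozenge p\wedge\lozenge\neg p)$ is $n+1$-tabular but is not even Kripke complete. (3) The logic $\mathbf{K}_n+(\square x\to x)$ is Kripke complete with respect to the class of reflexive frames. (4) The logic $\mathbf{K}_n+(\square x\to\square\square x)$ is Kripke complete with respect to the class of transitive frames.
   Context: Formulas: let $\mathsf{Prop}$ be an infinite set of propositional variables. $\mathsf{Form}$ is the smallest set containing $\mathsf{Prop}$ and containing $\neg\phi$, $\phi\oplus\psi$, $\square\phi$ whenever it contains $\phi,\psi$. Abbreviations: $\phi\to\psi$ is $\psi\oplus\neg\phi$; $\psi\odot\phi$ is $\neg(\neg\psi\oplus\neg\phi)$; $\phi\vee\psi$ is $(\phi\to\psi)\to\psi$; $\phi\wedge\psi$ is $\neg(\neg\phi\vee\neg\psi)$; $\lozenge\phi$ is $\neg\square\neg\phi$; $\phi\leftrightarrow\psi$ is $(\phi\to\psi)\odot(\psi\to\phi)$; $\phi^m$ is $\phi\odot\cdots\odot\phi$ ($m$ factors). For a positive integer $m$, $\text{Ł}_m=\{0,\frac1m,\ldots,\frac{m-1}{m},1\}\subseteq[0,1]$;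 $\mathrm{div}(n)$ is the set of positive divisors of $n$. Logics: a modal many-valued logic is a set $\mathbf{L}\subseteq\mathsf{Form}$ closed under modus ponens, uniform substitution, and the necessitation rule (from $\phi$ infer $\square\phi$), and containing: (i) $p\to(q\to p)$, $(p\to q)\to((q\to r)\to(p\to r))$, $((p\to q)\to q)\to((q\to p)\to p)$, $(\neg p\to\neg q)\to(q\to p)$; (ii) $\square(p\to q)\to(\square p\to\square q)$; (iii) $\square(p\oplus p)\leftrightarrow\square p\oplus\square p$ and $\square(p\odot p)\leftrightarrow\square p\odot\square p$; (iv) $\square(p\oplus p^m)\leftrightarrow(\square p\oplus(\square p)^m)$ for every positive integer $m$. $\mathbf{K}_n$ is the smallest modal many-valued logic that also contains an axiomatic base of the $n+1$-valued Łukasiewicz logic (the logic of the $\square$-free formulas that take the value $1$ under every assignment of values of $\text{Ł}_n$ to the variables). $\mathbf{K}_n+\phi_1+\cdots+\phi_k$ is the smallest modal many-valued logic containing $\mathbf{K}_n\cup\{\phi_1,\ldots,\phi_k\}$. Models: an $n+1$-valued Kripke model $\langle W,R,\mathrm{Val}\rangle$ consists of a non-empty set $W$, a relation $R\subseteq W\times W$ and a map $\mathrm{Val}:\mathsf{Prop}\times W\to\text{Ł}_n$, extended to formulas by $\mathrm{Val}(\phi\oplus\psi,w)=\min(\mathrm{Val}(\phi,w)+\mathrm{Val}(\psi,w),1)$, $\mathrm{Val}(\neg\phi,w)=1-\mathrm{Val}(\phi,w)$, $\mathrm{Val}(\square\phi,w)=\inf\{\mathrm{Val}(\phi,w')\mid(w,w')\in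 R\}$ (the infimum in $[0,1]$, so the infimum of the empty set is $1$). A formula $\phi$ is true in the model if $\mathrm{Val}(\phi,w)=1$ for every $w\in W$. Frames: a frame is a pair $\langle W,R\rangle$ with $W$ a non-empty set and $R\subseteq W\times W$; it is reflexive (transitive) if $R$ is. An $n+1$-valued model $\langle W',R',\mathrm{Val}\rangle$ is based on $\langle W,R\rangle$ if $W'=W$ and $R'=R$. A formula is valid in a frame if it is true in every $n+1$-valued Kripke model based on it. Write $Ru=\{v\mid(u,v)\in R\}$. An $n+1$-frame is a structure $\langle W,\{r_m\mid m\in\mathrm{div}(n)\},R\rangle$ where $W$ is a set, $R\subseteq W\times W$, $r_m\subseteq W$ for each $m\in\mathrm{div}(n)$, such that $r_n=W$, $r_m\cap r_k=r_{\gcd(m,k)}$ for all $m,k\in\mathrm{div}(n)$, and for every $m\in\mathrm{div}(n)$ every $R$-successor of an element of $r_m$ lies in $r_m$. A model $\langle W',R',\mathrm{Val}\rangle$ is based on this $n+1$-frame if $W'=W$, $R'=R$ and $\mathrm{Val}(p,w)\in\text{Ł}_m$ for all $m\in\mathrm{div}(n)$, $w\in r_m$, $p\in\mathsf{Prop}$. A formula is valid in an $n+1$-frame if it is true in every model based on it. Completeness: a logic $\mathbf{L}$ is Kripke complete (with respect to a class $K$ of frames) if there is a class $K$ of frames (resp. for the given class $K$) such that $\mathbf{L}$ is exactly the set of formulas valid in every frame of $K$. It is $n+1$-Kripke complete (with respect to a class $K$ of $n+1$-frames) if there is a class $K$ of $n+1$-frames (resp. for the given $K$) such that $\mathbf{L}$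 is exactly the set of formulas valid in every $n+1$-frame of $K$. It is $n+1$-tabular if there is a finite $n+1$-frame $\mathfrak{F}$ such that $\mathbf{L}$ is exactly the set of formulas valid in $\mathfrak{F}$.
   Formalization: In part (1) the axiom □p∨□¬p of L_1 is replaced by □(p∨¬p) in both claims; as printed, completeness fails, since a world with two distinct successors in r_1 can refute □p∨□¬p in a frame of the stated class. *)

theory Defs
  imports Complex_Main
begin

section \<open>Formulas\<close>

datatype 'v form =
    Var 'v
  | Neg "'v form"  (\<open>(\<open>open_block notation=\<open>prefix not\<close>\<close>\<^bold>\<not> _)\<close> [90] 90)
  | Oplus "'v form" "'v form"  (infixl \<open>\<^bold>\<oplus>\<close> 75)
  | Box "'v form"  (\<open>(\<open>open_block notation=\<open>prefix box\<close>\<close>\<box> _)\<close> [90] 90)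

definition Imp :: "'v form \<Rightarrow> 'v form \<Rightarrow> 'v form"  (infixr \<open>\<^bold>\<rightarrow>\<close> 55)
  where "\<phi> \<^bold>\<rightarrow> \<psi> = \<psi> \<^bold>\<oplus> \<^bold>\<not> \<phi>"

definition Odot :: "'v form \<Rightarrow> 'v form \<Rightarrow> 'v form"  (infixl \<open>\<^bold>\<odot>\<close> 80)
  where "\<psi> \<^bold>\<odot> \<phi> = \<^bold>\<not> (\<^bold>\<not> \<psi> \<^bold>\<oplus> \<^bold>\<not> \<phi>)"

definition Disj :: "'v form \<Rightarrow> 'v form \<Rightarrow> 'v form"  (infixl \<open>\<^bold>\<or>\<close> 65)
  where "\<phi> \<^bold>\<or> \<psi> = ((\<phi> \<^bold>\<rightarrow> \<psi>) \<^bold>\<rightarrow> \<psi>)"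

definition Conj :: "'v form \<Rightarrow> 'v form \<Rightarrow> 'v form"  (infixl \<open>\<^bold>\<and>\<close> 70)
  where "\<phi> \<^bold>\<and> \<psi> = \<^bold>\<not> (\<^bold>\<not> \<phi> \<^bold>\<or> \<^bold>\<not> \<psi>)"

definition Diamond :: "'v form \<Rightarrow> 'v form"  (\<open>(\<open>open_block notation=\<open>prefix diamond\<close>\<close>\<diamond> _)\<close> [90] 90)
  where "\<diamond> \<phi> = \<^bold>\<not> (\<box> (\<^bold>\<not> \<phi>))"

definition Iff :: "'v form \<Rightarrow> 'v form \<Rightarrow> 'v form"  (infix \<open>\<^bold>\<leftrightarrow>\<close> 50)
  where "(\<phi> \<^bold>\<leftrightarrow> \<psi>) = (\<phi> \<^bold>\<rightarrow> \<psi>) \<^bold>\<odot> (\<psi> \<^bold>\<rightarrow> \<phi>)"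

text \<open>The \<open>m\<close>-fold product of \<open>\<phi>\<close> with itself, bracketed to the right. It is only meant for
  \<open>m \<ge> 1\<close>; there is no constant that could serve as the empty product.\<close>

definition mpow :: "'v form \<Rightarrow> nat \<Rightarrow> 'v form"
  where "mpow \<phi> m = (Odot \<phi> ^^ (m - 1)) \<phi>"

primrec subst :: "('v \<Rightarrow> 'v form) \<Rightarrow> 'v form \<Rightarrow> 'v form" where
  "subst \<sigma> (Var p) = \<sigma> p"
| "subst \<sigma> (\<^bold>\<not> \<phi>) = \<^bold>\<not> (subst \<sigma> \<phi>)"
| "subst \<sigma> (\<phi> \<^bold>\<oplus> \<psi>) = subst \<sigma> \<phi> \<^bold>\<oplus> subst \<sigma> \<psi>"
| "subst \<sigma> (\<box> \<phi>) = \<box> (subst \<sigma> \<phi>)"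

primrec box_free :: "'v form \<Rightarrow> bool" where
  "box_free (Var p) \<longleftrightarrow> True"
| "box_free (\<^bold>\<not> \<phi>) \<longleftrightarrow> box_free \<phi>"
| "box_free (\<phi> \<^bold>\<oplus> \<psi>) \<longleftrightarrow> box_free \<phi> \<and> box_free \<psi>"
| "box_free (\<box> \<phi>) \<longleftrightarrow> False"

section \<open>Models\<close>

definition Luk :: "nat \<Rightarrow> real set"
  where "Luk m = {real k / real m | k. k \<le> m}"

text \<open>All values lie in \<open>[0,1]\<close>, so inserting \<open>1\<close> turns the real infimum into the infimum taken
  in \<open>[0,1]\<close>: it only matters when \<open>w\<close> has no successor, and then the value is \<open>1\<close>.\<close>

primrec eval :: "('w \<times> 'w) set \<Rightarrow> ('v \<Rightarrow> 'w \<Rightarrow> real) \<Rightarrow> 'v form \<Rightarrow> 'w \<Rightarrow> real" where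
  "eval R V (Var p) w = V p w"
| "eval R V (\<^bold>\<not> \<phi>) w = 1 - eval R V \<phi> w"
| "eval R V (\<phi> \<^bold>\<oplus> \<psi>) w = min (eval R V \<phi> w + eval R V \<psi> w) 1"
| "eval R V (\<box> \<phi>) w = Inf (insert 1 {eval R V \<phi> w' | w'. (w, w') \<in> R})"

text \<open>Valuations are total functions on \<open>'w\<close>; their values outside \<open>W\<close> play no role.\<close>

definition kripke_model :: "nat \<Rightarrow> 'w set \<Rightarrow> ('w \<times> 'w) set \<Rightarrow> ('v \<Rightarrow> 'w \<Rightarrow> real) \<Rightarrow> bool" where
  "kripke_model n W R V \<longleftrightarrow> W \<noteq> {} \<and> R \<subseteq> W \<times> W \<and> (\<forall>p. \<forall>w\<in>W. V p w \<in> Luk n)"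

definition true_in :: "'w set \<Rightarrow> ('w \<times> 'w) set \<Rightarrow> ('v \<Rightarrow> 'w \<Rightarrow> real) \<Rightarrow> 'v form \<Rightarrow> bool" where
  "true_in W R V \<phi> \<longleftrightarrow> (\<forall>w\<in>W. eval R V \<phi> w = 1)"

section \<open>Logics\<close>

text \<open>Since the set is closed under substitution, it is immaterial whether the axioms are
  required for some pairwise distinct variables or, as here, for all variables.\<close>

definition modal_mv_logic :: "'v form set \<Rightarrow> bool" where
  "modal_mv_logic L \<longleftrightarrow>
     (\<forall>\<phi> \<psi>. \<phi> \<in> L \<longrightarrow> (\<phi> \<^bold>\<rightarrow> \<psi>) \<in> L \<longrightarrow> \<psi> \<in> L) \<and>
     (\<forall>\<sigma> \<phi>. \<phi> \<in> L \<longrightarrow> subst \<sigma> \<phi> \<in> L) \<and>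
     (\<forall>\<phi>. \<phi> \<in> L \<longrightarrow> \<box> \<phi> \<in> L) \<and>
     (\<forall>p q r.
       (Var p \<^bold>\<rightarrow> (Var q \<^bold>\<rightarrow> Var p)) \<in> L \<and>
       ((Var p \<^bold>\<rightarrow> Var q) \<^bold>\<rightarrow> ((Var q \<^bold>\<rightarrow> Var r) \<^bold>\<rightarrow> (Var p \<^bold>\<rightarrow> Var r))) \<in> L \<and>
       (((Var p \<^bold>\<rightarrow> Var q) \<^bold>\<rightarrow> Var q) \<^bold>\<rightarrow> ((Var q \<^bold>\<rightarrow> Var p) \<^bold>\<rightarrow> Var p)) \<in> L \<and>
       ((\<^bold>\<not> Var p \<^bold>\<rightarrow> \<^bold>\<not> Var q) \<^bold>\<rightarrow> (Var q \<^bold>\<rightarrow> Var p)) \<in> L \<and>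
       (\<box> (Var p \<^bold>\<rightarrow> Var q) \<^bold>\<rightarrow> (\<box> (Var p) \<^bold>\<rightarrow> \<box> (Var q))) \<in> L \<and>
       (\<box> (Var p \<^bold>\<oplus> Var p) \<^bold>\<leftrightarrow> \<box> (Var p) \<^bold>\<oplus> \<box> (Var p)) \<in> L \<and>
       (\<box> (Var p \<^bold>\<odot> Var p) \<^bold>\<leftrightarrow> \<box> (Var p) \<^bold>\<odot> \<box> (Var p)) \<in> L \<and>
       (\<forall>m\<ge>1. (\<box> (Var p \<^bold>\<oplus> mpow (Var p) m) \<^bold>\<leftrightarrow> \<box> (Var p) \<^bold>\<oplus> mpow (\<box> (Var p)) m) \<in> L))"

text \<open>A propositional assignment is a valuation on a one-point set of worlds; the accessibility
  relation is irrelevant for \<open>\<box>\<close>-free formulas.\<close>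

definition luk_logic :: "nat \<Rightarrow> 'v form set" where
  "luk_logic n = {\<phi>. box_free \<phi> \<and>
     (\<forall>a. (\<forall>p. a p \<in> Luk n) \<longrightarrow> eval {} (\<lambda>p (_ :: unit). a p) \<phi> () = 1)}"

inductive_set prop_consequences :: "'v form set \<Rightarrow> 'v form set" for B where
  base: "\<phi> \<in> B \<Longrightarrow> \<phi> \<in> prop_consequences B"
| mp: "\<phi> \<in> prop_consequences B \<Longrightarrow> (\<phi> \<^bold>\<rightarrow> \<psi>) \<in> prop_consequences B \<Longrightarrow>
    \<psi> \<in> prop_consequences B"
| subst: "\<phi> \<in> prop_consequences B \<Longrightarrow> (\<And>p. box_free (\<sigma> p)) \<Longrightarrow>
    subst \<sigma> \<phi> \<in> prop_consequences B"

definition axiomatic_base :: "nat \<Rightarrow> 'v form set \<Rightarrow> bool" where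
  "axiomatic_base n B \<longleftrightarrow> prop_consequences B = luk_logic n"

definition logic_K :: "nat \<Rightarrow> 'v form set" where
  "logic_K n = \<Inter> {L. modal_mv_logic L \<and> (\<exists>B. axiomatic_base n B \<and> B \<subseteq> L)}"

text \<open>The logic obtained from \<open>logic_K n\<close> by adding the formulas in \<open>\<Phi>\<close> as axioms.\<close>

definition logic_K_plus :: "nat \<Rightarrow> 'v form set \<Rightarrow> 'v form set" where
  "logic_K_plus n \<Phi> = \<Inter> {L. modal_mv_logic L \<and> logic_K n \<union> \<Phi> \<subseteq> L}"

section \<open>Frames\<close>

type_synonym 'w frame = "'w set \<times> ('w \<times> 'w) set"

definition is_frame :: "'w frame \<Rightarrow> bool" where
  "is_frame = (\<lambda>(W, R). W \<noteq> {} \<and> R \<subseteq> W \<times> W)"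

definition valid :: "nat \<Rightarrow> 'w frame \<Rightarrow> 'v form \<Rightarrow> bool" where
  "valid n = (\<lambda>(W, R) \<phi>. \<forall>V. kripke_model n W R V \<longrightarrow> true_in W R V \<phi>)"

definition reflexive_frames :: "'w frame set" where
  "reflexive_frames = {(W, R). is_frame (W, R) \<and> refl_on W R}"

definition transitive_frames :: "'w frame set" where
  "transitive_frames = {(W, R). is_frame (W, R) \<and> trans R}"

text \<open>An \<open>n+1\<close>-frame \<open>(W, r, R)\<close>: only the sets \<open>r m\<close> with \<open>m dvd n\<close> are part of the
  structure, the function \<open>r\<close> is arbitrary elsewhere.\<close>

type_synonym 'w nframe = "'w set \<times> (nat \<Rightarrow> 'w set) \<times> ('w \<times> 'w) set"

definition is_nframe :: "nat \<Rightarrow> 'w nframe \<Rightarrow> bool" where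
  "is_nframe n = (\<lambda>(W, r, R).
     R \<subseteq> W \<times> W \<and>
     (\<forall>m. m dvd n \<longrightarrow> r m \<subseteq> W) \<and>
     r n = W \<and>
     (\<forall>m k. m dvd n \<longrightarrow> k dvd n \<longrightarrow> r m \<inter> r k = r (gcd m k)) \<and>
     (\<forall>m. m dvd n \<longrightarrow> (\<forall>u\<in>r m. R `` {u} \<subseteq> r m)))"

definition nvalid :: "nat \<Rightarrow> 'w nframe \<Rightarrow> 'v form \<Rightarrow> bool" where
  "nvalid n = (\<lambda>(W, r, R) \<phi>. \<forall>V.
     kripke_model n W R V \<and> (\<forall>m. m dvd n \<longrightarrow> (\<forall>w\<in>r m. \<forall>p. V p w \<in> Luk m)) \<longrightarrow>
     true_in W R V \<phi>)"

definition boolean_successor_nframes :: "nat \<Rightarrow> 'w nframe set" where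
  "boolean_successor_nframes n =
     {(W, r, R). is_nframe n (W, r, R) \<and> (\<forall>u\<in>W. R `` {u} \<subseteq> r 1)}"

section \<open>Completeness\<close>

text \<open>A class of frames is rendered as a set of frames whose worlds are taken from a type \<open>'w\<close>.
  Results stated for an arbitrary infinite \<open>'w\<close> therefore cover frames of every cardinality,
  and the negation of \<open>kripke_complete TYPE('w) n L\<close>, for all such \<open>'w\<close>, excludes every class
  of frames: a class determining \<open>L\<close> contains a set of frames that does, obtained by choosing one
  refuting frame for each formula outside \<open>L\<close>.\<close>

definition kripke_complete_wrt :: "nat \<Rightarrow> 'w frame set \<Rightarrow> 'v form set \<Rightarrow> bool" where
  "kripke_complete_wrt n K L \<longleftrightarrow> (\<forall>F\<in>K. is_frame F) \<and> L = {\<phi>. \<forall>F\<in>K. valid n F \<phi>}"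

definition kripke_complete :: "'w itself \<Rightarrow> nat \<Rightarrow> 'v form set \<Rightarrow> bool" where
  "kripke_complete TYPE('w) n L \<longleftrightarrow> (\<exists>K :: 'w frame set. kripke_complete_wrt n K L)"

definition nkripke_complete_wrt :: "nat \<Rightarrow> 'w nframe set \<Rightarrow> 'v form set \<Rightarrow> bool" where
  "nkripke_complete_wrt n K L \<longleftrightarrow> (\<forall>F\<in>K. is_nframe n F) \<and> L = {\<phi>. \<forall>F\<in>K. nvalid n F \<phi>}"

definition ntabular :: "'w itself \<Rightarrow> nat \<Rightarrow> 'v form set \<Rightarrow> bool" where
  "ntabular TYPE('w) n L \<longleftrightarrow>
     (\<exists>F :: 'w nframe. is_nframe n F \<and> finite (fst F) \<and> L = {\<phi>. nvalid n F \<phi>})"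

section \<open>A pitfall: \<open>\<box> (p \<or> \<not> p)\<close> versus \<open>\<box> p \<or> \<box> \<not> p\<close>\<close>

text \<open>The formula \<open>\<box> (p \<or> \<not> p)\<close> expresses that all successors are Boolean. The formula
  \<open>\<box> p \<or> \<box> \<not> p\<close> also forbids two distinct successors, so the logic it axiomatizes is not
  complete with respect to \<^const>\<open>boolean_successor_nframes\<close>.\<close>

lemma not_complete_box_or_box_not:
  assumes inf: "infinite (UNIV :: 'w set)" and n: "n \<ge> 2"
  shows "\<not> nkripke_complete_wrt n (boolean_successor_nframes n :: 'w nframe set)
           (logic_K_plus n {\<box> (Var p) \<^bold>\<or> \<box> (\<^bold>\<not> Var p)})"
proof
  let ?f = "\<box> (Var p) \<^bold>\<or> \<box> (\<^bold>\<not> Var p)"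
  assume c: "nkripke_complete_wrt n (boolean_successor_nframes n :: 'w nframe set) (logic_K_plus n {?f})"
  obtain A :: "'w set" where "card A = 3" "finite A"
    using infinite_arbitrarily_large[OF inf] by metis
  then obtain u a b :: 'w where d: "u \<noteq> a" "u \<noteq> b" "a \<noteq> b"
    by (auto simp: card_3_iff)
  define W where "W = {u, a, b}"
  define R where "R = {(u, a), (u, b)}"
  define r where "r = (\<lambda>m. if m = n then W else {a, b})"
  define V where "V = (\<lambda>(_ :: 'a) w. if w = a then 1 else 0 :: real)"
  have gcd_n: "gcd m k = n \<longleftrightarrow> m = n \<and> k = n" if "m dvd n" "k dvd n" for m k
    using that by (metis dvd_antisym gcd_dvd1 gcd_dvd2 gcd_idem_nat)
  have mem: "(W, r, R) \<in> boolean_successor_nframes n"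
    using n d gcd_n unfolding boolean_successor_nframes_def is_nframe_def r_def R_def W_def
    by (auto split: if_splits)
  have "?f \<in> logic_K_plus n {?f}" by (auto simp: logic_K_plus_def)
  with c mem have v: "nvalid n (W, r, R) ?f"
    unfolding nkripke_complete_wrt_def by blast
  have "V q w \<in> Luk m" if "m dvd n" for q w m
  proof -
    have "m > 0" using that n by (auto intro!: Nat.gr0I)
    then have "0 \<in> Luk m" "1 \<in> Luk m"
      unfolding Luk_def by (auto intro: exI[of _ 0] exI[of _ m])
    then show ?thesis by (simp add: V_def)
  qed
  then have "true_in W R V ?f"
    using v by (auto simp: nvalid_def kripke_model_def W_def R_def)
  then have one: "eval R V ?f u = 1" by (simp add: true_in_def W_def)
  have "{V p w' | w'. (u, w') \<in> R} = {0, 1}" "{1 - V p w' | w'. (u, w') \<in> R} = {0, 1}"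
    using d by (auto simp: R_def V_def)
  then have "eval R V (\<box> (Var p)) u = 0" "eval R V (\<box> (\<^bold>\<not> Var p)) u = 0"
    by (simp_all add: cInf_eq_Min)
  with one show False by (simp add: Disj_def Imp_def del: eval.simps(4))
qed

end

theory Submission
  imports Defs "HOL-Analysis.Function_Topology" "HOL-Library.Countable_Set"
begin

text \<open>
The completeness results rest on a canonical model. Its worlds are the maps from formulas to the
chain of \<open>n+1\<close> truth values that respect \<open>\<^bold>\<not>\<close> and \<open>\<^bold>\<oplus>\<close> and send the logic to \<open>1\<close>; a world \<open>v\<close> is accessible
from \<open>u\<close> if \<open>v \<phi> = 1\<close> whenever \<open>u (\<box> \<phi>) = 1\<close>. Two facts make it work. First, a formula outside a set
that contains the \<open>n+1\<close>-valued tautologies and is closed under modus ponens is sent to a value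
other than \<open>1\<close> by some homomorphism that is \<open>1\<close> on the set (\<open>hom_separation\<close>); this combines a deduction
theorem, in which each premise is used \<open>n\<close> times, with the compactness of a power of a finite set.
Second, \<open>\<box>\<close> commutes with the maps \<open>\<phi> \<mapsto> \<phi> \<^bold>\<oplus> \<phi>\<close> and \<open>\<phi> \<mapsto> \<phi> \<^bold>\<odot> \<phi>\<close>, hence with their composites, and for each
positive truth value some composite has the value \<open>1\<close> exactly when its argument has at least the given
value (\<open>threshold\<close>). The proof that the value of \<open>\<box> \<phi>\<close>
is the minimum of the values of \<open>\<phi>\<close> at the successors is thereby reduced to the value \<open>1\<close>
(\<open>truth_lemma\<close>). The axioms \<open>\<box> x \<^bold>\<rightarrow> x\<close> and \<open>\<box> x \<^bold>\<rightarrow> \<box> \<box> x\<close> make accessibility reflexive and transitive,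
and \<open>\<box> (p \<^bold>\<or> \<^bold>\<not> p)\<close> makes all successors Boolean.

The canonical model is too large for an arbitrary infinite type of worlds. Closing a refuting
world under the choice of successors at which the infima in the refuted formula are attained gives
a countable submodel, which can be copied into every infinite type (\<open>transported_submodel\<close>).
Reflexivity, transitivity and Booleanness of successors pass to submodels.

On a plain frame, \<open>\<box> (p \<^bold>\<or> \<^bold>\<not> p)\<close> is valid only if there are no successors at all, since variables may
take the value \<open>1/n\<close>. Then \<open>\<box> p\<close> is valid too, so a Kripke complete logic with this axiom contains
\<open>\<box> p\<close>; an \<open>n+1\<close>-frame with one Boolean successor shows that the two logics considered do not
(\<open>not_kripke_complete\<close>, \<open>fork_nframe_axioms\<close>).

In the canonical model of the second logic every world has at most one successor, and the successor
is Boolean and has no successors itself. Hence one \<open>n+1\<close>-frame with three worlds suffices: a world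
with a Boolean successor, that successor, and an isolated world (\<open>fork_nframe_complete\<close>).
\<close>

section \<open>Truth values and evaluation\<close>

lemma finite_Luk: "finite (Luk m)"
proof -
  have "Luk m = (\<lambda>k. real k / real m) ` {..m}" by (auto simp: Luk_def)
  then show ?thesis by simp
qed

lemma Luk_nonneg: "x \<in> Luk m \<Longrightarrow> 0 \<le> x"
  and Luk_le_1: "x \<in> Luk m \<Longrightarrow> x \<le> 1"
  by (auto simp: Luk_def divide_le_eq_1)

lemma Luk_0: "0 \<in> Luk m"
  unfolding Luk_def by (auto intro!: exI[of _ 0])

lemma Luk_1: "m > 0 \<Longrightarrow> 1 \<in> Luk m"
  unfolding Luk_def by (auto intro!: exI[of _ m])

lemma Luk_neg:
  assumes "m > 0" "x \<in> Luk m"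
  shows "1 - x \<in> Luk m"
proof -
  obtain k where "k \<le> m" "x = real k / real m" using assms by (auto simp: Luk_def)
  then have "1 - x = real (m - k) / real m" using assms by (simp add: field_simps )
  then show ?thesis by (auto simp: Luk_def)
qed

lemma Luk_oplus:
  assumes "m > 0" "x \<in> Luk m" "y \<in> Luk m"
  shows "min (x + y) 1 \<in> Luk m"
proof -
  obtain k l where "x = real k / real m" "y = real l / real m" using assms by (auto simp: Luk_def)
  then have "min (x + y) 1 = min ((real k + real l) / real m) (real m / real m)"
    using assms by (simp add: add_divide_distrib)
  also have "\<dots> = real (min (k + l) m) / real m"
    using min_divide_distrib_right[of "real k + real l" "real m" "real m"] assms(1)
    by (simp add: of_nat_min)
  finally have "min (x + y) 1 = real (min (k + l) m) / real m" .
  moreover have "min (k + l) m \<le> m" by simp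
  ultimately show ?thesis unfolding Luk_def by blast
qed

lemma Luk_gap:
  assumes "n > 0" "x \<in> Luk n" "y \<in> Luk n" "x < y"
  shows "x + 1 / real n \<le> y"
proof -
  obtain k l where "x = real k / real n" "y = real l / real n" using assms by (auto simp: Luk_def)
  then show ?thesis using assms(1,4)
    by (auto simp: divide_less_cancel add_divide_distrib[symmetric] intro!: divide_right_mono)
qed

lemma eval_Imp: "eval R V (\<phi> \<^bold>\<rightarrow> \<psi>) w = min (eval R V \<psi> w + (1 - eval R V \<phi> w)) 1"
  by (simp add: Imp_def)

lemma eval_Imp_eq_1_iff: "eval R V (\<phi> \<^bold>\<rightarrow> \<psi>) w = 1 \<longleftrightarrow> eval R V \<phi> w \<le> eval R V \<psi> w"
  by (auto simp: eval_Imp)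

lemma eval_Odot: "eval R V (\<phi> \<^bold>\<odot> \<psi>) w = max (eval R V \<phi> w + eval R V \<psi> w - 1) 0"
  by (auto simp: Odot_def)

lemma eval_Disj:
  "eval R V \<phi> w \<le> 1 \<Longrightarrow> eval R V \<psi> w \<le> 1 \<Longrightarrow>
    eval R V (\<phi> \<^bold>\<or> \<psi>) w = max (eval R V \<phi> w) (eval R V \<psi> w)"
  by (auto simp: Disj_def eval_Imp)

lemma eval_Conj:
  "0 \<le> eval R V \<phi> w \<Longrightarrow> 0 \<le> eval R V \<psi> w \<Longrightarrow>
    eval R V (\<phi> \<^bold>\<and> \<psi>) w = min (eval R V \<phi> w) (eval R V \<psi> w)"
  by (auto simp: Conj_def eval_Disj)

lemma eval_Iff: "eval R V \<phi> w = eval R V \<psi> w \<Longrightarrow> eval R V (\<phi> \<^bold>\<leftrightarrow> \<psi>) w = 1"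
  by (simp add: Iff_def eval_Odot eval_Imp)

lemma eval_mpow:
  assumes "1 \<le> m" "0 \<le> eval R V \<phi> w" "eval R V \<phi> w \<le> 1"
  shows "eval R V (mpow \<phi> m) w = max (1 - real m * (1 - eval R V \<phi> w)) 0"
proof -
  have "eval R V ((Odot \<phi> ^^ k) \<phi>) w = max (1 - real (Suc k) * (1 - eval R V \<phi> w)) 0" for k
  proof (induction k)
    case (Suc k)
    have "real (Suc k) * (1 - eval R V \<phi> w) \<ge> 0" using assms by simp
    then show ?case using Suc assms by (auto simp: eval_Odot algebra_simps max_def)
  qed (use assms in simp)
  from this[of "m - 1"] show ?thesis using assms(1) by (simp add: mpow_def)
qed

lemma eval_subst: "eval R V (subst \<sigma> \<phi>) w = eval R (\<lambda>p. eval R V (\<sigma> p)) \<phi> w"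
  by (induction \<phi> arbitrary: w) simp_all

text \<open>On a finite set of truth values the infimum is attained, except that it is \<open>1\<close> at a world
  without successors.\<close>

lemma eval_box_cases:
  assumes "eval R V \<phi> ` (R `` {w}) \<subseteq> Luk m"
  shows "(w, w') \<in> R \<Longrightarrow> eval R V (\<box> \<phi>) w \<le> eval R V \<phi> w'"
    and "eval R V (\<box> \<phi>) w \<le> 1"
    and "eval R V (\<box> \<phi>) w = 1 \<or> (\<exists>w'. (w, w') \<in> R \<and> eval R V (\<box> \<phi>) w = eval R V \<phi> w')"
proof -
  let ?A = "insert 1 {eval R V \<phi> w' | w'. (w, w') \<in> R}"
  have fin: "finite ?A"
    by (rule finite_subset[OF _ finite.insertI[OF finite_Luk[of m]]]) (use assms in auto)
  have eq: "eval R V (\<box> \<phi>) w = Min ?A"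
    using fin by (simp add: cInf_eq_Min)
  have "Min ?A \<in> ?A" using fin by (intro Min_in) auto
  then show "eval R V (\<box> \<phi>) w = 1 \<or> (\<exists>w'. (w, w') \<in> R \<and> eval R V (\<box> \<phi>) w = eval R V \<phi> w')"
    unfolding eq by blast
  show "eval R V (\<box> \<phi>) w \<le> 1" unfolding eq using fin by (intro Min_le) auto
  show "eval R V (\<box> \<phi>) w \<le> eval R V \<phi> w'" if "(w, w') \<in> R"
    unfolding eq using fin that by (intro Min_le) auto
qed

lemma eval_box_eqI:
  assumes "x \<le> 1" "\<And>w'. (w, w') \<in> R \<Longrightarrow> x \<le> eval R V \<phi> w'"
    and "x = 1 \<or> (\<exists>w'. (w, w') \<in> R \<and> eval R V \<phi> w' = x)"
  shows "eval R V (\<box> \<phi>) w = x"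
  unfolding eval.simps by (rule cInf_eq_minimum) (use assms in auto)

lemma eval_box_eq_1_iff:
  assumes "eval R V \<phi> ` (R `` {w}) \<subseteq> Luk m"
  shows "eval R V (\<box> \<phi>) w = 1 \<longleftrightarrow> (\<forall>w'. (w, w') \<in> R \<longrightarrow> eval R V \<phi> w' = 1)"
proof
  assume "eval R V (\<box> \<phi>) w = 1"
  then show "\<forall>w'. (w, w') \<in> R \<longrightarrow> eval R V \<phi> w' = 1"
    using eval_box_cases(1)[OF assms] assms Luk_le_1 by (metis Image_singleton_iff image_subset_iff order_antisym)
next
  assume "\<forall>w'. (w, w') \<in> R \<longrightarrow> eval R V \<phi> w' = 1"
  then show "eval R V (\<box> \<phi>) w = 1" by (intro eval_box_eqI) auto
qed

lemma eval_in_Luk: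
  assumes "m > 0" "R `` D \<subseteq> D" "\<And>p w. w \<in> D \<Longrightarrow> V p w \<in> Luk m"
  shows "w \<in> D \<Longrightarrow> eval R V \<phi> w \<in> Luk m"
proof (induction \<phi> arbitrary: w)
  case (Box \<phi>)
  have *: "eval R V \<phi> ` (R `` {w}) \<subseteq> Luk m" using Box assms(2) by blast
  show ?case using eval_box_cases(3)[OF *] * Luk_1[OF assms(1)] by auto
qed (simp_all add: assms(1,3) Luk_neg Luk_oplus)

lemma eval_box_mono:
  assumes "eval R V \<phi> ` (R `` {w}) \<subseteq> Luk m"
    and "\<And>w'. (w, w') \<in> R \<Longrightarrow> eval R V \<psi> w' = f (eval R V \<phi> w')"
    and "mono_on {0..1} f" "f 1 = 1"
  shows "eval R V (\<box> \<psi>) w = f (eval R V (\<box> \<phi>) w)"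
proof -
  note box = eval_box_cases[OF assms(1)]
  have s01: "0 \<le> eval R V \<phi> w'" "eval R V \<phi> w' \<le> 1" if "(w, w') \<in> R" for w'
    using assms(1) that Luk_nonneg Luk_le_1 by blast+
  have b01: "eval R V (\<box> \<phi>) w \<in> {0..1}"
    using box(2,3) s01 by fastforce
  show ?thesis
  proof (rule eval_box_eqI)
    show "f (eval R V (\<box> \<phi>) w) \<le> 1"
      using mono_onD[OF assms(3) b01, of 1] b01 assms(4) by auto
    show "f (eval R V (\<box> \<phi>) w) \<le> eval R V \<psi> w'" if "(w, w') \<in> R" for w'
      using mono_onD[OF assms(3) b01, of "eval R V \<phi> w'"] box(1)[OF that] assms(2)[OF that]
        s01[OF that] by auto
    show "f (eval R V (\<box> \<phi>) w) = 1 \<or> (\<exists>w'. (w, w') \<in> R \<and> eval R V \<psi> w' = f (eval R V (\<box> \<phi>) w))"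
      using box(3) assms(2,4) by metis
  qed
qed

text \<open>The invariance of truth along a p-morphism defined on an \<open>R'\<close>-closed set \<open>D\<close>.\<close>

lemma eval_p_morphism:
  assumes "R' `` D \<subseteq> D" "\<And>w. w \<in> D \<Longrightarrow> R `` {f w} = f ` (R' `` {w})"
    and "\<And>p w. w \<in> D \<Longrightarrow> V' p w = V p (f w)"
  shows "w \<in> D \<Longrightarrow> eval R' V' \<phi> w = eval R V \<phi> (f w)"
proof (induction \<phi> arbitrary: w)
  case (Box \<phi>)
  have "{eval R' V' \<phi> w' | w'. (w, w') \<in> R'} = eval R' V' \<phi> ` (R' `` {w})" by auto
  also have "\<dots> = eval R V \<phi> ` f ` (R' `` {w})"
    unfolding image_image using Box assms(1) by (intro image_cong) auto
  also have "\<dots> = eval R V \<phi> ` (R `` {f w})" by (simp only: assms(2)[OF Box.prems])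
  also have "\<dots> = {eval R V \<phi> w' | w'. (f w, w') \<in> R}" by auto
  finally show ?case by simp
qed (simp_all add: assms(3))

section \<open>Soundness\<close>

text \<open>The models based on an \<open>n+1\<close>-frame.\<close>

definition nmodel :: "nat \<Rightarrow> 'w nframe \<Rightarrow> ('v \<Rightarrow> 'w \<Rightarrow> real) \<Rightarrow> bool" where
  "nmodel n = (\<lambda>(W, r, R) V. kripke_model n W R V \<and>
     (\<forall>m. m dvd n \<longrightarrow> (\<forall>w\<in>r m. \<forall>p. V p w \<in> Luk m)))"

lemma nvalid_iff:
  "nvalid n (W, r, R) \<phi> \<longleftrightarrow> (\<forall>V. nmodel n (W, r, R) V \<longrightarrow> (\<forall>w\<in>W. eval R V \<phi> w = 1))"
  by (auto simp: nvalid_def nmodel_def true_in_def)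

lemma is_nframeD:
  assumes "is_nframe n (W, r, R)"
  shows "R \<subseteq> W \<times> W" "r n = W" "m dvd n \<Longrightarrow> R `` r m \<subseteq> r m"
proof -
  note F = assms[unfolded is_nframe_def prod.case]
  from F show "R \<subseteq> W \<times> W" by (elim conjE)
  from F show "r n = W" by (elim conjE)
  assume "m dvd n"
  with F have "\<forall>u\<in>r m. R `` {u} \<subseteq> r m" by (elim conjE) blast
  then show "R `` r m \<subseteq> r m" by blast
qed

lemma nmodel_eval_in_Luk:
  assumes "n > 0" "is_nframe n (W, r, R)" "nmodel n (W, r, R) V" "m dvd n" "w \<in> r m"
  shows "eval R V \<phi> w \<in> Luk m"
proof (rule eval_in_Luk[where D = "r m"])
  show "m > 0" using assms(1,4) by (rule dvd_pos_nat)
  show "R `` r m \<subseteq> r m" by (rule is_nframeD(3)[OF assms(2,4)])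
  show "V p w \<in> Luk m" if "w \<in> r m" for p w
    using assms(3,4) that unfolding nmodel_def prod.case by blast
qed (rule assms(5))

lemma nmodel_eval:
  assumes "n > 0" "is_nframe n (W, r, R)" "nmodel n (W, r, R) V" "w \<in> W"
  shows "eval R V \<phi> w \<in> Luk n"
  using nmodel_eval_in_Luk[OF assms(1-3), of n w] is_nframeD(2)[OF assms(2)] assms(4) by simp

text \<open>A plain frame behaves like the \<open>n+1\<close>-frame in which no proper divisor of \<open>n\<close> imposes a
  constraint, so that soundness has to be proved for \<open>n+1\<close>-frames only.\<close>

definition free_nframe :: "nat \<Rightarrow> 'w frame \<Rightarrow> 'w nframe" where
  "free_nframe n = (\<lambda>(W, R). (W, (\<lambda>m. if m = n then W else {}), R))"

lemma gcd_eq_iff_both: "m dvd n \<Longrightarrow> k dvd n \<Longrightarrow> gcd m k = n \<longleftrightarrow> m = n \<and> k = (n :: nat)"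
  by (metis dvd_antisym gcd_dvd1 gcd_dvd2 gcd_idem_nat)

text \<open>If all proper divisors of \<open>n\<close> get the same set, the condition on intersections is automatic:
  \<open>gcd m k = n\<close> holds only for \<open>m = k = n\<close>.\<close>

lemma is_nframe_two_valued:
  assumes "R \<subseteq> W \<times> W" "B \<subseteq> W" "R `` B \<subseteq> B"
  shows "is_nframe n (W, (\<lambda>m. if m = n then W else B), R)"
proof -
  have "(if m = n then W else B) \<inter> (if k = n then W else B) = (if gcd m k = n then W else B)"
    if "m dvd n" "k dvd n" for m k
    using gcd_eq_iff_both[OF that] assms(2) by auto
  then show ?thesis using assms unfolding is_nframe_def prod.case by (auto split: if_splits)
qed

lemma is_nframe_free: "is_frame F \<Longrightarrow> is_nframe n (free_nframe n F)"
  unfolding is_frame_def free_nframe_def by (cases F) (auto intro: is_nframe_two_valued)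

lemma nvalid_free: "nvalid n (free_nframe n F) \<phi> \<longleftrightarrow> valid n F \<phi>"
proof (cases F)
  case (Pair W R)
  have "(\<forall>m. m dvd n \<longrightarrow> (\<forall>w\<in>if m = n then W else {}. \<forall>p. V p w \<in> Luk m)) \<longleftrightarrow>
      (\<forall>p. \<forall>w\<in>W. V p w \<in> Luk n)" for V :: "'b \<Rightarrow> 'a \<Rightarrow> real"
    by (metis dvd_refl empty_iff)
  then show ?thesis
    unfolding Pair nvalid_def valid_def free_nframe_def kripke_model_def prod.case by blast
qed

text \<open>Substitution preserves validity because the value of every formula, not only that of a variable,
  stays in \<^term>\<open>Luk m\<close> on \<open>r m\<close>.\<close>

lemma nvalid_subst:
  assumes "n > 0" "is_nframe n F" "nvalid n F \<phi>"
  shows "nvalid n F (subst \<sigma> \<phi>)"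
proof -
  obtain W r R where F: "F = (W, r, R)" by (cases F) auto
  show ?thesis unfolding F nvalid_iff
  proof (intro allI impI)
    fix V :: "'b \<Rightarrow> 'a \<Rightarrow> real" assume V: "nmodel n (W, r, R) V"
    have "nmodel n (W, r, R) (\<lambda>p. eval R V (\<sigma> p))"
      using V nmodel_eval_in_Luk[OF assms(1) _ V] nmodel_eval[OF assms(1) _ V] assms(2)
      by (simp add: F nmodel_def kripke_model_def)
    with assms(3) show "\<forall>w\<in>W. eval R V (subst \<sigma> \<phi>) w = 1"
      by (auto simp: F nvalid_iff eval_subst)
  qed
qed

lemma modal_mv_logic_nvalid:
  assumes n: "n > 0" and F: "is_nframe n F"
  shows "modal_mv_logic {\<phi>. nvalid n F \<phi>}"
proof -
  obtain W r R where F_eq: "F = (W, r, R)" by (cases F) auto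
  have nvalidI: "nvalid n F \<phi>"
    if "\<And>V w. w \<in> W \<Longrightarrow> (\<And>\<psi> w. w \<in> W \<Longrightarrow> eval R V \<psi> w \<in> Luk n) \<Longrightarrow> eval R V \<phi> w = 1"
    for \<phi> :: "'b form"
    unfolding F_eq nvalid_iff
  proof (intro allI impI ballI)
    fix V :: "'b \<Rightarrow> 'a \<Rightarrow> real" and w assume "nmodel n (W, r, R) V" "w \<in> W"
    then show "eval R V \<phi> w = 1"
      using nmodel_eval[OF n F[unfolded F_eq]] by (intro that) auto
  qed
  have succ: "w' \<in> W" if "(w, w') \<in> R" for w w'
    using is_nframeD(1)[OF F[unfolded F_eq]] that by auto
  \<comment> \<open>Infima are attained, so \<open>\<box>\<close> commutes with every monotone function that fixes \<open>1\<close>.\<close>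
  have box_comm: "nvalid n F (\<box> \<psi> \<^bold>\<leftrightarrow> \<chi>)"
    if "mono_on {0..1} f" "f 1 = 1"
      and "\<And>V w. 0 \<le> eval R V \<phi> w \<Longrightarrow> eval R V \<phi> w \<le> 1 \<Longrightarrow> eval R V \<psi> w = f (eval R V \<phi> w)"
      and "\<And>V w. 0 \<le> eval R V (\<box> \<phi>) w \<Longrightarrow> eval R V (\<box> \<phi>) w \<le> 1 \<Longrightarrow>
            eval R V \<chi> w = f (eval R V (\<box> \<phi>) w)"
    for \<phi> \<psi> \<chi> :: "'b form" and f
  proof (rule nvalidI, rule eval_Iff)
    fix V :: "'b \<Rightarrow> 'a \<Rightarrow> real" and w assume w: "w \<in> W" and V: "\<And>\<psi> w. w \<in> W \<Longrightarrow> eval R V \<psi> w \<in> Luk n"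
    have "eval R V (\<box> \<psi>) w = f (eval R V (\<box> \<phi>) w)"
    proof (rule eval_box_mono)
      show "eval R V \<phi> ` (R `` {w}) \<subseteq> Luk n" using succ V by blast
      show "eval R V \<psi> w' = f (eval R V \<phi> w')" if "(w, w') \<in> R" for w'
        using \<open>\<And>V w. 0 \<le> eval R V \<phi> w \<Longrightarrow> _ \<Longrightarrow> eval R V \<psi> w = _\<close> 
          Luk_nonneg[OF V] Luk_le_1[OF V] succ[OF that] by blast
    qed fact+
    then show "eval R V (\<box> \<psi>) w = eval R V \<chi> w"
      using that(4)[of V w] Luk_nonneg[OF V[OF w]] Luk_le_1[OF V[OF w]] by metis
  qed
  show ?thesis
    unfolding modal_mv_logic_def mem_Collect_eq
  proof (intro conjI allI impI)
    fix \<phi> \<psi> :: "'b form"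
    assume *: "nvalid n F \<phi>" "nvalid n F (\<phi> \<^bold>\<rightarrow> \<psi>)"
    show "nvalid n F \<psi>" unfolding F_eq nvalid_iff
    proof (intro allI impI ballI)
      fix V :: "'b \<Rightarrow> 'a \<Rightarrow> real" and w assume V: "nmodel n (W, r, R) V" "w \<in> W"
      have "eval R V \<phi> w = 1" "eval R V (\<phi> \<^bold>\<rightarrow> \<psi>) w = 1" "eval R V \<psi> w \<le> 1"
        using * V Luk_le_1[OF nmodel_eval[OF n _ V]] F by (simp_all add: F_eq nvalid_iff)
      then show "eval R V \<psi> w = 1" by (simp add: eval_Imp)
    qed
  next
    fix \<sigma> and \<phi> :: "'b form" assume "nvalid n F \<phi>"
    then show "nvalid n F (subst \<sigma> \<phi>)" by (rule nvalid_subst[OF n F])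
  next
    fix \<phi> :: "'b form" assume *: "nvalid n F \<phi>"
    show "nvalid n F (\<box> \<phi>)" unfolding F_eq nvalid_iff
    proof (intro allI impI ballI)
      fix V :: "'b \<Rightarrow> 'a \<Rightarrow> real" and w assume "nmodel n (W, r, R) V" "w \<in> W"
      then show "eval R V (\<box> \<phi>) w = 1"
        using * succ by (intro eval_box_eqI) (auto simp: F_eq nvalid_iff)
    qed
  next
    fix p q r :: 'b
    show "nvalid n F (Var p \<^bold>\<rightarrow> (Var q \<^bold>\<rightarrow> Var p))"
      "nvalid n F ((Var p \<^bold>\<rightarrow> Var q) \<^bold>\<rightarrow> ((Var q \<^bold>\<rightarrow> Var r) \<^bold>\<rightarrow> (Var p \<^bold>\<rightarrow> Var r)))"
      "nvalid n F (((Var p \<^bold>\<rightarrow> Var q) \<^bold>\<rightarrow> Var q) \<^bold>\<rightarrow> ((Var q \<^bold>\<rightarrow> Var p) \<^bold>\<rightarrow> Var p))"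
      "nvalid n F ((\<^bold>\<not> Var p \<^bold>\<rightarrow> \<^bold>\<not> Var q) \<^bold>\<rightarrow> (Var q \<^bold>\<rightarrow> Var p))"
    proof (rule_tac [!] nvalidI)
      fix V :: "'b \<Rightarrow> 'a \<Rightarrow> real" and w
      assume "w \<in> W" and V: "\<And>\<psi> w. w \<in> W \<Longrightarrow> eval R V \<psi> w \<in> Luk n"
      then have b: "0 \<le> V x w" "V x w \<le> 1" for x
        using Luk_nonneg[OF V, of w "Var x"] Luk_le_1[OF V, of w "Var x"] by simp_all
      show "eval R V (Var p \<^bold>\<rightarrow> (Var q \<^bold>\<rightarrow> Var p)) w = 1"
        using b[of p] b[of q] unfolding eval_Imp_eq_1_iff by (simp add: eval_Imp)
      show "eval R V ((Var p \<^bold>\<rightarrow> Var q) \<^bold>\<rightarrow> ((Var q \<^bold>\<rightarrow> Var r) \<^bold>\<rightarrow> (Var p \<^bold>\<rightarrow> Var r))) w = 1"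
        unfolding eval_Imp_eq_1_iff by (simp add: eval_Imp min_def)
      show "eval R V (((Var p \<^bold>\<rightarrow> Var q) \<^bold>\<rightarrow> Var q) \<^bold>\<rightarrow> ((Var q \<^bold>\<rightarrow> Var p) \<^bold>\<rightarrow> Var p)) w = 1"
        using b[of p] b[of q] unfolding eval_Imp_eq_1_iff by (simp add: eval_Imp min_def)
      show "eval R V ((\<^bold>\<not> Var p \<^bold>\<rightarrow> \<^bold>\<not> Var q) \<^bold>\<rightarrow> (Var q \<^bold>\<rightarrow> Var p)) w = 1"
        unfolding eval_Imp_eq_1_iff by (simp add: eval_Imp)
    qed
    show "nvalid n F (\<box> (Var p \<^bold>\<rightarrow> Var q) \<^bold>\<rightarrow> (\<box> (Var p) \<^bold>\<rightarrow> \<box> (Var q)))"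
    proof (rule nvalidI)
      fix V :: "'b \<Rightarrow> 'a \<Rightarrow> real" and w assume w: "w \<in> W" and V: "\<And>\<psi> w. w \<in> W \<Longrightarrow> eval R V \<psi> w \<in> Luk n"
      have "eval R V \<psi> ` (R `` {w}) \<subseteq> Luk n" for \<psi> using succ V by blast
      note box = eval_box_cases[OF this]
      have "eval R V (\<box> (Var p \<^bold>\<rightarrow> Var q)) w + eval R V (\<box> (Var p)) w
          \<le> 1 + eval R V (\<box> (Var q)) w"
      proof (cases "eval R V (\<box> (Var q)) w = 1")
        case True
        then show ?thesis using box(2)[of "Var p \<^bold>\<rightarrow> Var q"] box(2)[of "Var p"] by linarith
      next
        case False
        then obtain w' where w': "(w, w') \<in> R" "eval R V (\<box> (Var q)) w = V q w'"
          using box(3)[of "Var q"] by auto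
        have "eval R V (\<box> (Var p \<^bold>\<rightarrow> Var q)) w \<le> V q w' + (1 - V p w')"
          using box(1)[of w' "Var p \<^bold>\<rightarrow> Var q"] w' by (auto simp: eval_Imp)
        moreover have "eval R V (\<box> (Var p)) w \<le> V p w'"
          using box(1)[of w' "Var p"] w' by auto
        ultimately show ?thesis using w'(2) by linarith
      qed
      then show "eval R V (\<box> (Var p \<^bold>\<rightarrow> Var q) \<^bold>\<rightarrow> (\<box> (Var p) \<^bold>\<rightarrow> \<box> (Var q))) w = 1"
        using box(2)[of "Var p \<^bold>\<rightarrow> Var q"] by (auto simp: eval_Imp simp del: eval.simps(4))
    qed
    show "nvalid n F (\<box> (Var p \<^bold>\<oplus> Var p) \<^bold>\<leftrightarrow> \<box> (Var p) \<^bold>\<oplus> \<box> (Var p))"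
      by (rule box_comm[where f = "\<lambda>x. min (x + x) 1" and \<phi> = "Var p"])
        (auto intro!: mono_onI simp del: eval.simps(4))
    show "nvalid n F (\<box> (Var p \<^bold>\<odot> Var p) \<^bold>\<leftrightarrow> \<box> (Var p) \<^bold>\<odot> \<box> (Var p))"
      by (rule box_comm[where f = "\<lambda>x. max (x + x - 1) 0" and \<phi> = "Var p"])
        (auto intro!: mono_onI simp: eval_Odot simp del: eval.simps(4))
    fix m :: nat assume m: "1 \<le> m"
    show "nvalid n F (\<box> (Var p \<^bold>\<oplus> mpow (Var p) m) \<^bold>\<leftrightarrow> \<box> (Var p) \<^bold>\<oplus> mpow (\<box> (Var p)) m)"
    proof (rule box_comm[where f = "\<lambda>x. min (x + max (1 - real m * (1 - x)) 0) 1" and \<phi> = "Var p"])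
      show "mono_on {0..1} (\<lambda>x. min (x + max (1 - real m * (1 - x)) 0) 1)"
      proof (rule mono_onI)
        fix x y :: real assume "x \<le> y"
        then have "real m * (1 - y) \<le> real m * (1 - x)" by (intro mult_left_mono) auto
        with \<open>x \<le> y\<close> show "min (x + max (1 - real m * (1 - x)) 0) 1
            \<le> min (y + max (1 - real m * (1 - y)) 0) 1" by linarith
      qed
    qed (use m in \<open>auto simp: eval_mpow simp del: eval.simps(4)\<close>)
  qed
qed

lemma eval_box_free: "box_free \<phi> \<Longrightarrow> eval R V \<phi> w = eval R' (\<lambda>p _. V p w) \<phi> w'"
  by (induction \<phi>) auto

lemma luk_logic_nvalid:
  fixes \<phi> :: "'v form"
  assumes "\<phi> \<in> luk_logic n"
  shows "nvalid n F \<phi>"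
proof -
  obtain W r R where F: "F = (W, r, R)" by (cases F) auto
  show ?thesis unfolding F nvalid_iff
  proof (intro allI impI ballI)
    fix V :: "'v \<Rightarrow> _" and w assume "nmodel n (W, r, R) V" "w \<in> W"
    then have "eval {} (\<lambda>p (_ :: unit). V p w) \<phi> () = 1"
      using assms by (auto simp: luk_logic_def nmodel_def kripke_model_def)
    then show "eval R V \<phi> w = 1"
      using assms eval_box_free[of \<phi> R V w "{}" "()"] by (simp add: luk_logic_def)
  qed
qed

lemma axiomatic_base_luk_logic:
  assumes "n > 0"
  shows "axiomatic_base n (luk_logic n)"
proof -
  have "\<phi> \<in> luk_logic n" if "\<phi> \<in> prop_consequences (luk_logic n)" for \<phi> :: "'a form"
    using that
  proof induction
    case (mp \<phi> \<psi>)
    have "eval {} (\<lambda>p _. a p) \<psi> () = 1" if "\<And>p. a p \<in> Luk n" for a :: "'a \<Rightarrow> real"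
    proof -
      have "eval {} (\<lambda>p _. a p) \<psi> () \<le> 1"
        by (rule Luk_le_1[of _ n], rule eval_in_Luk[where D = UNIV]) (use that assms in auto)
      moreover have "eval {} (\<lambda>p (_ :: unit). a p) \<phi> () = 1"
        "eval {} (\<lambda>p (_ :: unit). a p) (\<phi> \<^bold>\<rightarrow> \<psi>) () = 1"
        using mp.IH that unfolding luk_logic_def by blast+
      ultimately show ?thesis by (simp add: eval_Imp)
    qed
    with mp.IH show ?case by (auto simp: luk_logic_def Imp_def)
  next
    case (subst \<phi> \<sigma>)
    have "box_free (subst \<sigma> \<phi>)" if "box_free \<phi>" using that subst(2) by (induction \<phi>) auto
    moreover have "eval {} (\<lambda>p (_ :: unit). a p) (Defs.subst \<sigma> \<phi>) () = 1"
      if "\<And>p. a p \<in> Luk n" for a :: "'a \<Rightarrow> real"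
    proof -
      let ?b = "\<lambda>p. eval {} (\<lambda>p (_ :: unit). a p) (\<sigma> p) ()"
      have "?b p \<in> Luk n" for p
        by (rule eval_in_Luk[where D = UNIV]) (use that assms in auto)
      then have "eval {} (\<lambda>p (_ :: unit). ?b p) \<phi> () = 1"
        by (intro subst.IH[unfolded luk_logic_def mem_Collect_eq, THEN conjunct2, rule_format])
      moreover have "(\<lambda>p (_ :: unit). ?b p) = (\<lambda>p. eval {} (\<lambda>p (_ :: unit). a p) (\<sigma> p))"
        by simp
      ultimately show ?thesis by (simp only: eval_subst)
    qed
    ultimately show ?case using subst by (simp add: luk_logic_def)
  qed auto
  then show ?thesis unfolding axiomatic_base_def by (auto intro: prop_consequences.base)
qed

lemma soundness:
  assumes "n > 0" "is_nframe n F" "\<And>\<phi>. \<phi> \<in> \<Phi> \<Longrightarrow> nvalid n F \<phi>" "\<phi> \<in> logic_K_plus n \<Phi>"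
  shows "nvalid n F \<phi>"
proof -
  let ?L = "{\<phi>. nvalid n F \<phi>}"
  have "modal_mv_logic ?L" by (rule modal_mv_logic_nvalid[OF assms(1,2)])
  moreover have "logic_K n \<subseteq> ?L"
    using calculation axiomatic_base_luk_logic[OF assms(1)] luk_logic_nvalid
    unfolding logic_K_def by blast
  ultimately show ?thesis using assms(3,4) unfolding logic_K_plus_def by blast
qed

section \<open>Homomorphisms into the finite chain\<close>

text \<open>A homomorphism for the propositional connectives alone: boxed formulas are treated like
  variables.\<close>

definition luk_hom :: "nat \<Rightarrow> ('v form \<Rightarrow> real) \<Rightarrow> bool" where
  "luk_hom n h \<longleftrightarrow> (\<forall>\<phi>. h \<phi> \<in> Luk n) \<and> (\<forall>\<phi>. h (\<^bold>\<not> \<phi>) = 1 - h \<phi>) \<and>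
     (\<forall>\<phi> \<psi>. h (\<phi> \<^bold>\<oplus> \<psi>) = min (h \<phi> + h \<psi>) 1)"

lemma luk_hom_Luk: "luk_hom n h \<Longrightarrow> h \<phi> \<in> Luk n"
  and luk_hom_Neg: "luk_hom n h \<Longrightarrow> h (\<^bold>\<not> \<phi>) = 1 - h \<phi>"
  and luk_hom_Oplus: "luk_hom n h \<Longrightarrow> h (\<phi> \<^bold>\<oplus> \<psi>) = min (h \<phi> + h \<psi>) 1"
  by (simp_all add: luk_hom_def)

lemma luk_hom_le_1: "luk_hom n h \<Longrightarrow> h \<phi> \<le> 1"
  and luk_hom_nonneg: "luk_hom n h \<Longrightarrow> 0 \<le> h \<phi>"
  using luk_hom_Luk Luk_le_1 Luk_nonneg by blast+

lemma luk_hom_Imp: "luk_hom n h \<Longrightarrow> h (\<phi> \<^bold>\<rightarrow> \<psi>) = min (h \<psi> + (1 - h \<phi>)) 1"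
  by (simp add: Imp_def luk_hom_Neg luk_hom_Oplus)

lemma luk_hom_Odot: "luk_hom n h \<Longrightarrow> h (\<phi> \<^bold>\<odot> \<psi>) = max (h \<phi> + h \<psi> - 1) 0"
  by (auto simp: Odot_def luk_hom_Neg luk_hom_Oplus)

lemma luk_hom_Disj: "luk_hom n h \<Longrightarrow> h (\<phi> \<^bold>\<or> \<psi>) = max (h \<phi>) (h \<psi>)"
  using luk_hom_le_1[of n h \<phi>] luk_hom_le_1[of n h \<psi>] by (auto simp: Disj_def luk_hom_Imp)

lemma luk_hom_Conj: "luk_hom n h \<Longrightarrow> h (\<phi> \<^bold>\<and> \<psi>) = min (h \<phi>) (h \<psi>)"
  by (auto simp: Conj_def luk_hom_Disj luk_hom_Neg)

lemma luk_hom_Iff_eq_1: "luk_hom n h \<Longrightarrow> h (\<phi> \<^bold>\<leftrightarrow> \<psi>) = 1 \<Longrightarrow> h \<phi> = h \<psi>"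
  by (simp add: Iff_def luk_hom_Odot luk_hom_Imp max_def min_def split: if_splits)

text \<open>The homomorphism with prescribed values on the variables and the boxed formulas.\<close>

primrec hom_ext :: "('v form \<Rightarrow> real) \<Rightarrow> 'v form \<Rightarrow> real" where
  "hom_ext a (Var p) = a (Var p)"
| "hom_ext a (\<^bold>\<not> \<phi>) = 1 - hom_ext a \<phi>"
| "hom_ext a (\<phi> \<^bold>\<oplus> \<psi>) = min (hom_ext a \<phi> + hom_ext a \<psi>) 1"
| "hom_ext a (\<box> \<phi>) = a (\<box> \<phi>)"

lemma luk_hom_hom_ext:
  assumes "n > 0" "\<And>\<phi>. a \<phi> \<in> Luk n"
  shows "luk_hom n (hom_ext a)"
proof -
  have "hom_ext a \<phi> \<in> Luk n" for \<phi>
    by (induction \<phi>) (simp_all add: assms Luk_neg Luk_oplus)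
  then show ?thesis by (simp add: luk_hom_def)
qed

text \<open>The variables outside the scope of \<open>\<box>\<close> and the outermost boxed subformulas. Replacing them by
  distinct variables turns the formula into a \<open>\<box>\<close>-free one of which it is a substitution instance.\<close>

primrec prop_atoms :: "'v form \<Rightarrow> 'v form set" where
  "prop_atoms (Var p) = {Var p}"
| "prop_atoms (\<^bold>\<not> \<phi>) = prop_atoms \<phi>"
| "prop_atoms (\<phi> \<^bold>\<oplus> \<psi>) = prop_atoms \<phi> \<union> prop_atoms \<psi>"
| "prop_atoms (\<box> \<phi>) = {\<box> \<phi>}"

text \<open>The \<open>\<box>\<close>-free formula obtained by writing the variable \<open>e \<alpha>\<close> for each such subformula \<open>\<alpha>\<close>.\<close>

primrec skeleton :: "('v form \<Rightarrow> 'v) \<Rightarrow> 'v form \<Rightarrow> 'v form" where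
  "skeleton e (Var p) = Var (e (Var p))"
| "skeleton e (\<^bold>\<not> \<phi>) = \<^bold>\<not> (skeleton e \<phi>)"
| "skeleton e (\<phi> \<^bold>\<oplus> \<psi>) = skeleton e \<phi> \<^bold>\<oplus> skeleton e \<psi>"
| "skeleton e (\<box> \<phi>) = Var (e (\<box> \<phi>))"

lemma finite_prop_atoms: "finite (prop_atoms \<phi>)"
  by (induction \<phi>) simp_all

lemma box_free_skeleton: "box_free (skeleton e \<phi>)"
  by (induction \<phi>) simp_all

lemma eval_skeleton: "eval {} (\<lambda>p _. a p) (skeleton e \<phi>) w = hom_ext (\<lambda>\<alpha>. a (e \<alpha>)) \<phi>"
  by (induction \<phi>) simp_all

lemma subst_skeleton:
  assumes "\<And>\<alpha>. \<alpha> \<in> prop_atoms \<phi> \<Longrightarrow> \<sigma> (e \<alpha>) = \<alpha>"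
  shows "subst \<sigma> (skeleton e \<phi>) = \<phi>"
  using assms by (induction \<phi>) simp_all

lemma
  assumes "modal_mv_logic L"
  shows modal_mv_logic_mp: "\<phi> \<in> L \<Longrightarrow> (\<phi> \<^bold>\<rightarrow> \<psi>) \<in> L \<Longrightarrow> \<psi> \<in> L"
    and modal_mv_logic_subst: "\<phi> \<in> L \<Longrightarrow> subst \<sigma> \<phi> \<in> L"
    and modal_mv_logic_nec: "\<phi> \<in> L \<Longrightarrow> \<box> \<phi> \<in> L"
proof -
  note L = assms[unfolded modal_mv_logic_def]
  show "\<phi> \<in> L \<Longrightarrow> (\<phi> \<^bold>\<rightarrow> \<psi>) \<in> L \<Longrightarrow> \<psi> \<in> L"
    by (rule L[THEN conjunct1, rule_format])
  show "\<phi> \<in> L \<Longrightarrow> subst \<sigma> \<phi> \<in> L"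
    by (rule L[THEN conjunct2, THEN conjunct1, rule_format])
  show "\<phi> \<in> L \<Longrightarrow> \<box> \<phi> \<in> L"
    by (rule L[THEN conjunct2, THEN conjunct2, THEN conjunct1, rule_format])
qed

text \<open>Only finitely many distinct variables are needed, whatever the cardinality of the set of
  variables.\<close>

lemma tautology_in_logic:
  fixes \<phi> :: "'v form"
  assumes inf: "infinite (UNIV :: 'v set)" and "n > 0"
    and "luk_logic n \<subseteq> L" "modal_mv_logic L"
    and taut: "\<And>h. luk_hom n h \<Longrightarrow> h \<phi> = 1"
  shows "\<phi> \<in> L"
proof -
  obtain B :: "'v set" where "finite B" "card B = card (prop_atoms \<phi>)"
    using infinite_arbitrarily_large[OF inf] by metis
  then obtain e where e: "bij_betw e (prop_atoms \<phi>) B"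
    using finite_same_card_bij[OF finite_prop_atoms] by metis
  have "skeleton e \<phi> \<in> luk_logic n"
    using taut[OF luk_hom_hom_ext[OF \<open>n > 0\<close>]]
    by (simp add: luk_logic_def box_free_skeleton eval_skeleton)
  then have "subst (inv_into (prop_atoms \<phi>) e) (skeleton e \<phi>) \<in> L"
    using assms(3) modal_mv_logic_subst[OF assms(4)] by blast
  then show ?thesis
    using subst_skeleton[of \<phi> "inv_into (prop_atoms \<phi>) e" e] e
    by (simp add: bij_betw_def)
qed

text \<open>A set of formulas that contains the tautologies of the \<open>n+1\<close>-valued logic and is closed under
  modus ponens. A modal logic is one, and so is the set of the formulas \<open>\<phi>\<close> such that \<open>\<box> \<phi>\<close> has the
  value \<open>1\<close> at a given world of its canonical model.\<close>

definition luk_theory :: "nat \<Rightarrow> 'v form set \<Rightarrow> bool" where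
  "luk_theory n S \<longleftrightarrow> (\<forall>\<phi>. (\<forall>h. luk_hom n h \<longrightarrow> h \<phi> = 1) \<longrightarrow> \<phi> \<in> S) \<and>
     (\<forall>\<phi> \<psi>. \<phi> \<in> S \<longrightarrow> (\<phi> \<^bold>\<rightarrow> \<psi>) \<in> S \<longrightarrow> \<psi> \<in> S)"

lemma luk_theory_tautology: "luk_theory n S \<Longrightarrow> (\<And>h. luk_hom n h \<Longrightarrow> h \<phi> = 1) \<Longrightarrow> \<phi> \<in> S"
  by (simp add: luk_theory_def)

lemma luk_theory_mp: "luk_theory n S \<Longrightarrow> \<phi> \<in> S \<Longrightarrow> (\<phi> \<^bold>\<rightarrow> \<psi>) \<in> S \<Longrightarrow> \<psi> \<in> S"
  unfolding luk_theory_def by (drule conjunct2) blast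

lemma luk_hom_foldr_Imp:
  assumes "luk_hom n h"
  shows "h (foldr Imp l \<phi>) = min (h \<phi> + (\<Sum>\<psi>\<leftarrow>l. 1 - h \<psi>)) 1"
proof (induction l)
  case (Cons \<psi> l)
  then show ?case using luk_hom_le_1[OF assms, of \<psi>] by (simp add: luk_hom_Imp[OF assms] min_def)
qed (simp add: luk_hom_le_1[OF assms])

lemma foldr_Imp_mp: "luk_theory n S \<Longrightarrow> set l \<subseteq> S \<Longrightarrow> foldr Imp l \<phi> \<in> S \<Longrightarrow> \<phi> \<in> S"
proof (induction l)
  case (Cons \<psi> l)
  then have "\<psi> \<in> S" "(\<psi> \<^bold>\<rightarrow> foldr Imp l \<phi>) \<in> S" by simp_all
  then have "foldr Imp l \<phi> \<in> S" by (rule luk_theory_mp[OF Cons.prems(1)])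
  with Cons show ?case by simp
qed simp

text \<open>The deduction theorem for finitely many premises. Each premise is used \<open>n\<close> times: a premise
  with a value below \<open>1\<close> loses at least \<open>1/n\<close> each time.\<close>

lemma hom_separation_finite:
  assumes n: "n > 0" and T: "finite T" "T \<subseteq> S"
    and S: "luk_theory n S"
    and "\<phi> \<notin> S"
  shows "\<exists>h. luk_hom n h \<and> (\<forall>\<psi>\<in>T. h \<psi> = 1) \<and> h \<phi> \<noteq> 1"
proof (rule ccontr)
  assume no: "\<not> ?thesis"
  obtain l where l: "set l = T" using finite_list[OF T(1)] by blast
  let ?l = "concat (replicate n l)"
  have "foldr Imp ?l \<phi> \<in> S"
  proof (rule luk_theory_tautology[OF S])
    fix h :: "'a form \<Rightarrow> real" assume h: "luk_hom n h"
    let ?s = "\<lambda>l. \<Sum>\<psi>\<leftarrow>l. 1 - h \<psi>"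
    have pos: "0 \<le> ?s l" for l
      by (rule sum_list_nonneg) (use luk_hom_le_1[OF h] in auto)
    have rep: "?s (concat (replicate k l)) = real k * ?s l" for k
      by (induction k) (simp_all add: algebra_simps)
    have "1 \<le> h \<phi> + ?s ?l"
    proof (cases "\<forall>\<psi>\<in>T. h \<psi> = 1")
      case True
      then show ?thesis using no h pos[of ?l] by auto
    next
      case False
      then obtain \<psi> where \<psi>: "\<psi> \<in> T" "h \<psi> < 1"
        using luk_hom_le_1[OF h] by (meson order_le_less)
      then obtain xs ys where xy: "l = xs @ \<psi> # ys" using l split_list[of \<psi> l] by auto
      have "h \<psi> + 1 / real n \<le> 1"
        by (rule Luk_gap[OF n luk_hom_Luk[OF h] Luk_1[OF n] \<psi>(2)])
      then have "1 / real n \<le> ?s l" using pos[of xs] pos[of ys] by (simp add: xy)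
      then have "1 \<le> real n * ?s l" using n by (simp add: field_simps)
      then show ?thesis using luk_hom_nonneg[OF h, of \<phi>] by (simp add: rep)
    qed
    then show "h (foldr Imp ?l \<phi>) = 1" by (simp add: luk_hom_foldr_Imp[OF h])
  qed
  moreover have "set ?l \<subseteq> S" using T(2) l by auto
  ultimately have "\<phi> \<in> S" using foldr_Imp_mp[OF S] by blast
  then show False using \<open>\<phi> \<notin> S\<close> by blast
qed

lemma closed_coordinate_eq: "closed {h :: 'a \<Rightarrow> real. h x = c}"
  by (intro closed_Collect_eq continuous_on_const continuous_on_product_coordinates)

text \<open>Compactness of the space of homomorphisms removes the finiteness assumption.\<close>

lemma hom_separation:
  fixes S :: "'v form set"
  assumes n: "n > 0"
    and S: "luk_theory n S"
    and "\<phi> \<notin> S"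
  shows "\<exists>h. luk_hom n h \<and> (\<forall>\<psi>\<in>S. h \<psi> = 1) \<and> h \<phi> \<noteq> 1"
proof -
  let ?P = "PiE UNIV (\<lambda>_ :: 'v form. Luk n)"
  let ?N = "\<lambda>\<psi>. {h :: 'v form \<Rightarrow> real. h (\<^bold>\<not> \<psi>) = 1 - h \<psi>}"
  let ?O = "\<lambda>\<psi> \<chi>. {h :: 'v form \<Rightarrow> real. h (\<psi> \<^bold>\<oplus> \<chi>) = min (h \<psi> + h \<chi>) 1}"
  let ?Q = "{h :: 'v form \<Rightarrow> real. h \<phi> \<le> 1 - 1 / real n}"
  let ?K = "?P \<inter> ((\<Inter>\<psi>. ?N \<psi>) \<inter> (\<Inter>\<psi> \<chi>. ?O \<psi> \<chi>) \<inter> ?Q)"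
  have K: "?K = {h. luk_hom n h \<and> h \<phi> \<noteq> 1}"
  proof -
    have "h \<phi> \<le> 1 - 1 / real n \<longleftrightarrow> h \<phi> \<noteq> 1" if "luk_hom n h" for h
    proof
      show "h \<phi> \<noteq> 1" if "h \<phi> \<le> 1 - 1 / real n" using that n by auto
      assume "h \<phi> \<noteq> 1"
      then have "h \<phi> < 1" using luk_hom_le_1[OF that, of \<phi>] by simp
      then show "h \<phi> \<le> 1 - 1 / real n"
        using Luk_gap[OF n luk_hom_Luk[OF that] Luk_1[OF n]] by fastforce
    qed
    moreover have "?P \<inter> ((\<Inter>\<psi>. ?N \<psi>) \<inter> (\<Inter>\<psi> \<chi>. ?O \<psi> \<chi>)) = {h. luk_hom n h}"
      unfolding luk_hom_def PiE_UNIV_domain by blast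
    ultimately show ?thesis by blast
  qed
  have "compact (Luk n)" by (rule finite_imp_compact[OF finite_Luk])
  then have "compact ?P"
    using compactin_PiE[of "\<lambda>_ :: 'v form. euclidean :: real topology" UNIV "\<lambda>_. Luk n"]
    by (simp add: euclidean_product_topology)
  moreover have "closed ((\<Inter>\<psi>. ?N \<psi>) \<inter> (\<Inter>\<psi> \<chi>. ?O \<psi> \<chi>) \<inter> ?Q)"
    by (intro closed_Int closed_INT ballI closed_Collect_eq closed_Collect_le continuous_intros
        continuous_on_product_coordinates)
  ultimately have "compact ?K" by (rule compact_Int_closed)
  moreover have "closed X" if "X \<in> (\<lambda>\<psi>. {h. h \<psi> = 1}) ` S" for X :: "('v form \<Rightarrow> real) set"
    using that closed_coordinate_eq by auto
  moreover have "?K \<inter> \<Inter> F \<noteq> {}" if F: "finite F" "F \<subseteq> (\<lambda>\<psi>. {h. h \<psi> = 1}) ` S" for F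
  proof -
    obtain T where T: "finite T" "T \<subseteq> S" "F = (\<lambda>\<psi>. {h. h \<psi> = 1}) ` T"
      using finite_subset_image[OF F] by blast
    obtain h where "luk_hom n h" "\<forall>\<psi>\<in>T. h \<psi> = 1" "h \<phi> \<noteq> 1"
      using hom_separation_finite[OF n T(1,2) S assms(3)] by blast
    then have "h \<in> ?K \<inter> \<Inter> F" unfolding K T(3) by blast
    then show ?thesis by blast
  qed
  ultimately have "?K \<inter> \<Inter> ((\<lambda>\<psi>. {h. h \<psi> = 1}) ` S) \<noteq> {}" by (rule compact_imp_fip)
  then show ?thesis unfolding K by blast
qed

section \<open>The canonical model\<close>

text \<open>An arbitrary modal many-valued logic that contains the tautologies of the \<open>n+1\<close>-valued
  \<open>\<box>\<close>-free logic.\<close>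

locale luk_modal_logic =
  fixes n :: nat and L :: "'v form set"
  assumes n_pos: "n > 0" and inf: "infinite (UNIV :: 'v set)"
    and logic: "modal_mv_logic L" and luk: "luk_logic n \<subseteq> L"
begin

lemma theory_L: "luk_theory n L"
  unfolding luk_theory_def
proof (intro conjI allI impI)
  fix \<phi> :: "'v form" assume "\<forall>h. luk_hom n h \<longrightarrow> h \<phi> = 1"
  then show "\<phi> \<in> L" by (intro tautology_in_logic[OF inf n_pos luk logic]) simp
next
  show "\<psi> \<in> L" if "\<phi> \<in> L" "(\<phi> \<^bold>\<rightarrow> \<psi>) \<in> L" for \<phi> \<psi>
    by (rule modal_mv_logic_mp[OF logic that])
qed

lemmas subst = modal_mv_logic_subst[OF logic]
  and nec = modal_mv_logic_nec[OF logic]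

lemma box_K: "(\<box> (\<phi> \<^bold>\<rightarrow> \<psi>) \<^bold>\<rightarrow> (\<box> \<phi> \<^bold>\<rightarrow> \<box> \<psi>)) \<in> L"
proof -
  obtain p q :: 'v where "p \<noteq> q"
    using inf by (metis (full_types) ex_new_if_finite finite.emptyI finite_insert insertI1)
  have "(\<box> (Var p \<^bold>\<rightarrow> Var q) \<^bold>\<rightarrow> (\<box> (Var p) \<^bold>\<rightarrow> \<box> (Var q))) \<in> L"
    using logic unfolding modal_mv_logic_def by blast
  from subst[OF this, of "\<lambda>r. if r = p then \<phi> else \<psi>"] \<open>p \<noteq> q\<close> show ?thesis
    by (simp add: Imp_def)
qed

lemma box_Oplus: "(\<box> (\<phi> \<^bold>\<oplus> \<phi>) \<^bold>\<leftrightarrow> \<box> \<phi> \<^bold>\<oplus> \<box> \<phi>) \<in> L"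
proof -
  have "(\<box> (Var p \<^bold>\<oplus> Var p) \<^bold>\<leftrightarrow> \<box> (Var p) \<^bold>\<oplus> \<box> (Var p)) \<in> L" for p
    using logic unfolding modal_mv_logic_def by blast
  from subst[OF this, of "\<lambda>_. \<phi>"] show ?thesis by (simp add: Iff_def Odot_def Imp_def)
qed

lemma box_Odot: "(\<box> (\<phi> \<^bold>\<odot> \<phi>) \<^bold>\<leftrightarrow> \<box> \<phi> \<^bold>\<odot> \<box> \<phi>) \<in> L"
proof -
  have "(\<box> (Var p \<^bold>\<odot> Var p) \<^bold>\<leftrightarrow> \<box> (Var p) \<^bold>\<odot> \<box> (Var p)) \<in> L" for p
    using logic unfolding modal_mv_logic_def by blast
  from subst[OF this, of "\<lambda>_. \<phi>"] show ?thesis by (simp add: Iff_def Odot_def Imp_def)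
qed

text \<open>The worlds, the accessibility relation and the valuation of the canonical model.\<close>

definition worlds :: "('v form \<Rightarrow> real) set" where
  "worlds = {h. luk_hom n h \<and> (\<forall>\<phi>\<in>L. h \<phi> = 1)}"

definition acc :: "(('v form \<Rightarrow> real) \<times> ('v form \<Rightarrow> real)) set" where
  "acc = {(u, v). u \<in> worlds \<and> v \<in> worlds \<and> (\<forall>\<phi>. u (\<box> \<phi>) = 1 \<longrightarrow> v \<phi> = 1)}"

definition val :: "'v \<Rightarrow> ('v form \<Rightarrow> real) \<Rightarrow> real" where
  "val p u = u (Var p)"

lemma worlds_hom: "u \<in> worlds \<Longrightarrow> luk_hom n u"
  and worlds_L: "u \<in> worlds \<Longrightarrow> \<phi> \<in> L \<Longrightarrow> u \<phi> = 1"
  by (auto simp: worlds_def)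

lemma accD: "(u, v) \<in> acc \<Longrightarrow> u (\<box> \<phi>) = 1 \<Longrightarrow> v \<phi> = 1"
  by (auto simp: acc_def)

lemma acc_worlds: "(u, v) \<in> acc \<Longrightarrow> u \<in> worlds" "(u, v) \<in> acc \<Longrightarrow> v \<in> worlds"
  by (auto simp: acc_def)

lemma ramp_double:
  fixes x :: real
  shows "min (max 0 (min 1 x) + max 0 (min 1 x)) 1 = max 0 (min 1 (2 * x))"
    and "max (max 0 (min 1 x) + max 0 (min 1 x) - 1) 0 = max 0 (min 1 (2 * x - 1))"
  by linarith+

text \<open>The composites of the maps \<open>\<phi> \<mapsto> \<phi> \<^bold>\<oplus> \<phi>\<close> and \<open>\<phi> \<mapsto> \<phi> \<^bold>\<odot> \<phi>\<close> induce every piecewise linear map that rises from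
  \<open>0\<close> to \<open>1\<close> on the dyadic interval between \<open>j / 2 ^ m\<close> and \<open>(j + 1) / 2 ^ m\<close>; the binary digits
  of \<open>j\<close> say which map to apply at each stage.\<close>

lemma dyadic_ramp:
  "j < 2 ^ m \<Longrightarrow> \<exists>t. \<forall>u\<in>worlds. \<forall>\<phi>.
     u (t \<phi>) = max 0 (min 1 (2 ^ m * u \<phi> - real j)) \<and>
     u (\<box> (t \<phi>)) = max 0 (min 1 (2 ^ m * u (\<box> \<phi>) - real j))"
proof (induction m arbitrary: j)
  case 0
  then show ?case
    by (intro exI[of _ id]) (auto dest!: worlds_hom simp: luk_hom_le_1 luk_hom_nonneg)
next
  case (Suc m)
  define i where "i = j div 2"
  have "i < 2 ^ m" using Suc.prems by (auto simp: i_def)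
  with Suc.IH obtain t where t: "\<And>u \<phi>. u \<in> worlds \<Longrightarrow>
      u (t \<phi>) = max 0 (min 1 (2 ^ m * u \<phi> - real i)) \<and>
      u (\<box> (t \<phi>)) = max 0 (min 1 (2 ^ m * u (\<box> \<phi>) - real i))"
    by metis
  show ?case
  proof (cases "even j")
    case True
    then have "j = 2 * i" by (simp add: i_def)
    then have j: "2 ^ Suc m * x - real j = 2 * (2 ^ m * x - real i)" for x :: real by simp
    show ?thesis
    proof (intro exI[of _ "\<lambda>\<phi>. t \<phi> \<^bold>\<oplus> t \<phi>"] ballI allI)
      fix u and \<phi> :: "'v form" assume u: "u \<in> worlds"
      have "u (\<box> (t \<phi> \<^bold>\<oplus> t \<phi>)) = min (u (\<box> (t \<phi>)) + u (\<box> (t \<phi>))) 1"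
        using luk_hom_Iff_eq_1[OF worlds_hom[OF u] worlds_L[OF u box_Oplus]]
        by (simp add: luk_hom_Oplus[OF worlds_hom[OF u]])
      then show "u (t \<phi> \<^bold>\<oplus> t \<phi>) = max 0 (min 1 (2 ^ Suc m * u \<phi> - real j)) \<and>
          u (\<box> (t \<phi> \<^bold>\<oplus> t \<phi>)) = max 0 (min 1 (2 ^ Suc m * u (\<box> \<phi>) - real j))"
        using t[OF u, of \<phi>] by (simp only: luk_hom_Oplus[OF worlds_hom[OF u]] j ramp_double)
    qed
  next
    case False
    then have "j = 2 * i + 1" by (simp add: i_def)
    then have j: "2 ^ Suc m * x - real j = 2 * (2 ^ m * x - real i) - 1" for x :: real by simp
    show ?thesis
    proof (intro exI[of _ "\<lambda>\<phi>. t \<phi> \<^bold>\<odot> t \<phi>"] ballI allI)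
      fix u and \<phi> :: "'v form" assume u: "u \<in> worlds"
      have "u (\<box> (t \<phi> \<^bold>\<odot> t \<phi>)) = max (u (\<box> (t \<phi>)) + u (\<box> (t \<phi>)) - 1) 0"
        using luk_hom_Iff_eq_1[OF worlds_hom[OF u] worlds_L[OF u box_Odot]]
        by (simp add: luk_hom_Odot[OF worlds_hom[OF u]])
      then show "u (t \<phi> \<^bold>\<odot> t \<phi>) = max 0 (min 1 (2 ^ Suc m * u \<phi> - real j)) \<and>
          u (\<box> (t \<phi> \<^bold>\<odot> t \<phi>)) = max 0 (min 1 (2 ^ Suc m * u (\<box> \<phi>) - real j))"
        using t[OF u, of \<phi>] by (simp only: luk_hom_Odot[OF worlds_hom[OF u]] j ramp_double)
    qed
  qed
qed

text \<open>Some composite has the value \<open>1\<close> exactly at the truth values from \<open>k / n\<close> on, and it commutes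
  with \<open>\<box>\<close>.\<close>

lemma threshold:
  assumes k: "0 < k" "k \<le> n"
  obtains t where "\<And>u \<phi>. u \<in> worlds \<Longrightarrow> u (t \<phi>) = 1 \<longleftrightarrow> real k / real n \<le> u \<phi>"
    and "\<And>u \<phi>. u \<in> worlds \<Longrightarrow> u (\<box> (t \<phi>)) = 1 \<longleftrightarrow> real k / real n \<le> u (\<box> \<phi>)"
proof -
  \<comment> \<open>The dyadic number \<open>q / 2 ^ n\<close> lies above \<open>(k - 1) / n\<close> and not above \<open>k / n\<close>, since \<open>n < 2 ^ n\<close>;
    the ramp that ends at \<open>q / 2 ^ n\<close> is used.\<close>
  define q where "q = 2 ^ n * k div n"
  have n2: "n < 2 ^ n" by (rule less_exp)
  have q_lower: "2 ^ n * k < q * n + n"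
  proof -
    have "2 ^ n * k = q * n + (2 ^ n * k) mod n" unfolding q_def by (rule div_mult_mod_eq[symmetric])
    moreover have "(2 ^ n * k) mod n < n" using n_pos by (rule mod_less_divisor)
    ultimately show ?thesis by linarith
  qed
  have q_upper: "q * n \<le> 2 ^ n * k" unfolding q_def by (rule div_times_less_eq_dividend)
  have "q \<noteq> 0"
  proof
    assume "q = 0"
    then have "2 ^ n * k < n" using q_lower by simp
    moreover have "2 ^ n * 1 \<le> 2 ^ n * k" using k by (intro mult_left_mono) auto
    ultimately show False using n2 by linarith
  qed
  have "q * n \<le> 2 ^ n * n" using q_upper k(2) by (meson mult_le_mono2 order_trans)
  then have "q \<le> 2 ^ n" using n_pos by simp
  have iff: "real q \<le> 2 ^ n * x \<longleftrightarrow> real k / real n \<le> x" if x: "x \<in> Luk n" for x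
  proof -
    obtain i where i: "x = real i / real n" using x by (auto simp: Luk_def)
    have "q * n \<le> 2 ^ n * i \<longleftrightarrow> k \<le> i"
    proof
      assume "k \<le> i"
      then show "q * n \<le> 2 ^ n * i" using q_upper by (meson mult_le_mono2 order_trans)
    next
      assume *: "q * n \<le> 2 ^ n * i"
      show "k \<le> i"
      proof (rule ccontr)
        assume "\<not> k \<le> i"
        then have "2 ^ n * (i + 1) \<le> 2 ^ n * k" by (intro mult_left_mono) auto
        then have "2 ^ n * i + 2 ^ n < q * n + n" using q_lower by simp
        with * n2 show False by linarith
      qed
    qed
    moreover have "real q \<le> 2 ^ n * x \<longleftrightarrow> real (q * n) \<le> real (2 ^ n * i)"
      using n_pos by (simp add: i field_simps)
    ultimately show ?thesis using n_pos by (simp only: of_nat_le_iff) (simp add: i divide_le_cancel)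
  qed
  have "q - 1 < 2 ^ n" using \<open>q \<noteq> 0\<close> \<open>q \<le> 2 ^ n\<close> by linarith
  from dyadic_ramp[OF this] obtain t where t: "\<And>u \<phi>. u \<in> worlds \<Longrightarrow>
      u (t \<phi>) = max 0 (min 1 (2 ^ n * u \<phi> - real (q - 1))) \<and>
      u (\<box> (t \<phi>)) = max 0 (min 1 (2 ^ n * u (\<box> \<phi>) - real (q - 1)))"
    by metis
  have one: "max 0 (min 1 (2 ^ n * x - real (q - 1))) = 1 \<longleftrightarrow> real k / real n \<le> x"
    if "x \<in> Luk n" for x
    using iff[OF that] \<open>q \<noteq> 0\<close> by (simp add: max_def min_def) linarith
  show ?thesis
    by (rule that[of t]) (simp_all only: t one luk_hom_Luk[OF worlds_hom])
qed

lemma acc_le: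
  assumes "(u, v) \<in> acc"
  shows "u (\<box> \<phi>) \<le> v \<phi>"
proof -
  note uv = acc_worlds[OF assms]
  obtain k where k: "k \<le> n" "u (\<box> \<phi>) = real k / real n"
    using luk_hom_Luk[OF worlds_hom[OF uv(1)]] by (auto simp: Luk_def)
  show ?thesis
  proof (cases "k = 0")
    case True
    then show ?thesis using k luk_hom_nonneg[OF worlds_hom[OF uv(2)]] by simp
  next
    case False
    then obtain t where "\<And>u \<phi>. u \<in> worlds \<Longrightarrow> u (t \<phi>) = 1 \<longleftrightarrow> real k / real n \<le> u \<phi>"
      and "\<And>u \<phi>. u \<in> worlds \<Longrightarrow> u (\<box> (t \<phi>)) = 1 \<longleftrightarrow> real k / real n \<le> u (\<box> \<phi>)"
      using threshold[of k] k(1) by (metis not_gr_zero)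
    then show ?thesis using accD[OF assms, of "t \<phi>"] uv k by simp
  qed
qed

text \<open>If \<open>u (\<box> \<phi>) = k / n < 1\<close>, then \<open>u (\<box> (t \<phi>)) \<noteq> 1\<close> for the threshold \<open>t\<close> at \<open>(k + 1) / n\<close>, and the
  formulas \<open>\<psi>\<close> with \<open>u (\<box> \<psi>) = 1\<close> can be separated from \<open>t \<phi>\<close>.\<close>

lemma acc_attained:
  assumes u: "u \<in> worlds" and "u (\<box> \<phi>) \<noteq> 1"
  obtains v where "(u, v) \<in> acc" "v \<phi> = u (\<box> \<phi>)"
proof -
  note hom = worlds_hom[OF u]
  obtain k where k: "k \<le> n" "u (\<box> \<phi>) = real k / real n"
    using luk_hom_Luk[OF hom] by (auto simp: Luk_def)
  have "Suc k \<le> n" using assms(2) k n_pos by (cases "k = n") auto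
  then obtain t where t: "\<And>u \<phi>. u \<in> worlds \<Longrightarrow> u (t \<phi>) = 1 \<longleftrightarrow> real (Suc k) / real n \<le> u \<phi>"
    "\<And>u \<phi>. u \<in> worlds \<Longrightarrow> u (\<box> (t \<phi>)) = 1 \<longleftrightarrow> real (Suc k) / real n \<le> u (\<box> \<phi>)"
    using threshold[of "Suc k"] by blast
  let ?S = "{\<psi>. u (\<box> \<psi>) = 1}"
  have t_notin: "t \<phi> \<notin> ?S" using t(2)[OF u, of \<phi>] k n_pos by (simp add: divide_le_cancel)
  have theory_S: "luk_theory n ?S"
    unfolding luk_theory_def mem_Collect_eq
  proof (intro conjI allI impI)
    fix \<psi> :: "'v form" assume "\<forall>h. luk_hom n h \<longrightarrow> h \<psi> = 1"
    then have "\<psi> \<in> L" using theory_L unfolding luk_theory_def by blast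
    then show "u (\<box> \<psi>) = 1" by (rule worlds_L[OF u nec])
  next
    fix \<psi> \<chi> assume "u (\<box> \<psi>) = 1" "u (\<box> (\<psi> \<^bold>\<rightarrow> \<chi>)) = 1"
    then show "u (\<box> \<chi>) = 1"
      using worlds_L[OF u box_K[of \<psi> \<chi>]] luk_hom_le_1[OF hom, of "\<box> \<chi>"]
      by (simp add: luk_hom_Imp[OF hom])
  qed
  obtain v where v: "luk_hom n v" "\<forall>\<psi>\<in>?S. v \<psi> = 1" "v (t \<phi>) \<noteq> 1"
    using hom_separation[OF n_pos theory_S t_notin] by blast
  have v2: "v \<psi> = 1" if "u (\<box> \<psi>) = 1" for \<psi> using v(2) that by blast
  have "v \<psi> = 1" if "\<psi> \<in> L" for \<psi> by (rule v2[OF worlds_L[OF u nec[OF that]]])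
  then have "v \<in> worlds" using v(1) by (simp add: worlds_def)
  then have acc: "(u, v) \<in> acc" using v2 u by (simp add: acc_def)
  have "v \<phi> < real (Suc k) / real n" using t(1)[OF \<open>v \<in> worlds\<close>] v(3) by force
  moreover obtain i where i: "v \<phi> = real i / real n"
    using luk_hom_Luk[OF v(1)] by (auto simp: Luk_def)
  ultimately have "v \<phi> \<le> u (\<box> \<phi>)" using k n_pos by (simp add: divide_less_cancel divide_le_cancel)
  with acc_le[OF acc, of \<phi>] that[OF acc] show ?thesis by simp
qed

theorem truth_lemma: "u \<in> worlds \<Longrightarrow> eval acc val \<phi> u = u \<phi>"
proof (induction \<phi> arbitrary: u)
  case (Box \<phi>)
  have IH: "eval acc val \<phi> v = v \<phi>" if "(u, v) \<in> acc" for v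
    using Box.IH acc_worlds(2)[OF that] by blast
  show ?case
  proof (rule eval_box_eqI)
    show "u (\<box> \<phi>) \<le> 1" by (rule luk_hom_le_1[OF worlds_hom[OF Box.prems]])
    show "u (\<box> \<phi>) \<le> eval acc val \<phi> v" if "(u, v) \<in> acc" for v
      using acc_le[OF that] IH[OF that] by simp
    show "u (\<box> \<phi>) = 1 \<or> (\<exists>v. (u, v) \<in> acc \<and> eval acc val \<phi> v = u (\<box> \<phi>))"
      using acc_attained[OF Box.prems, of \<phi>] IH by metis
  qed
qed (simp_all add: val_def luk_hom_Neg[OF worlds_hom] luk_hom_Oplus[OF worlds_hom])

lemma refuting_world:
  assumes "\<phi> \<notin> L"
  obtains u where "u \<in> worlds" "u \<phi> \<noteq> 1"
proof -
  obtain h where "luk_hom n h" "\<forall>\<psi>\<in>L. h \<psi> = 1" "h \<phi> \<noteq> 1"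
    using hom_separation[OF n_pos theory_L assms] by blast
  then show ?thesis using that[of h] by (simp add: worlds_def)
qed

lemma val_Luk: "u \<in> worlds \<Longrightarrow> val p u \<in> Luk n"
  unfolding val_def by (rule luk_hom_Luk[OF worlds_hom])

end

section \<open>Countable submodels\<close>

text \<open>A function assigning to each world finitely many worlds such that every set of worlds closed
  under it carries a submodel in which \<open>\<phi>\<close> keeps its values.\<close>

definition witness_fun ::
    "'w set \<Rightarrow> ('w \<times> 'w) set \<Rightarrow> ('v \<Rightarrow> 'w \<Rightarrow> real) \<Rightarrow> 'v form \<Rightarrow> ('w \<Rightarrow> 'w set) \<Rightarrow> bool" where
  "witness_fun W R V \<phi> g \<longleftrightarrow> (\<forall>w. finite (g w)) \<and> (\<forall>w\<in>W. g w \<subseteq> W) \<and>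
    (\<forall>D w. D \<subseteq> W \<longrightarrow> (\<forall>w\<in>D. g w \<subseteq> D) \<longrightarrow> w \<in> D \<longrightarrow>
      eval (R \<inter> D \<times> D) V \<phi> w = eval R V \<phi> w)"

lemma witness_funD:
  assumes "witness_fun W R V \<phi> g"
  shows "finite (g w)" "w \<in> W \<Longrightarrow> g w \<subseteq> W"
    "D \<subseteq> W \<Longrightarrow> \<forall>w\<in>D. g w \<subseteq> D \<Longrightarrow> w \<in> D \<Longrightarrow> eval (R \<inter> D \<times> D) V \<phi> w = eval R V \<phi> w"
  using assms unfolding witness_fun_def by simp_all

lemma witness_funI:
  assumes "\<And>w. finite (g w)" "\<And>w. w \<in> W \<Longrightarrow> g w \<subseteq> W"
    and "\<And>D w. D \<subseteq> W \<Longrightarrow> \<forall>w\<in>D. g w \<subseteq> D \<Longrightarrow> w \<in> D \<Longrightarrow>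
      eval (R \<inter> D \<times> D) V \<phi> w = eval R V \<phi> w"
  shows "witness_fun W R V \<phi> g"
  using assms unfolding witness_fun_def by simp

text \<open>For a boxed formula the function also has to select a successor at which the infimum is
  attained.\<close>

lemma witness_fun_exists:
  assumes n: "n > 0" and R: "R \<subseteq> W \<times> W" and V: "\<forall>p. \<forall>w\<in>W. V p w \<in> Luk n"
  shows "\<exists>g. witness_fun W R V \<phi> g"
proof (induction \<phi>)
  case (Var p)
  show ?case by (rule exI[of _ "\<lambda>_. {}"], rule witness_funI) simp_all
next
  case (Neg \<phi>)
  then obtain g where "witness_fun W R V \<phi> g" ..
  note g = witness_funD[OF this]
  show ?case by (rule exI[of _ g], rule witness_funI) (simp_all add: g)
next
  case (Oplus \<phi> \<psi>)
  then obtain g h where "witness_fun W R V \<phi> g" "witness_fun W R V \<psi> h" by blast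
  note g = witness_funD[OF this(1)] and h = witness_funD[OF this(2)]
  show ?case
  proof (rule exI[of _ "\<lambda>w. g w \<union> h w"], rule witness_funI)
    fix D w assume D: "D \<subseteq> W" "\<forall>w\<in>D. g w \<union> h w \<subseteq> D" "w \<in> D"
    have "\<forall>w\<in>D. g w \<subseteq> D" "\<forall>w\<in>D. h w \<subseteq> D" using D(2) by blast+
    then show "eval (R \<inter> D \<times> D) V (\<phi> \<^bold>\<oplus> \<psi>) w = eval R V (\<phi> \<^bold>\<oplus> \<psi>) w"
      by (simp add: g(3) h(3) D(1,3))
  qed (simp_all add: g(1,2) h(1,2))
next
  case (Box \<phi>)
  then obtain g where "witness_fun W R V \<phi> g" ..
  note g = witness_funD[OF this]
  define P where "P = (\<lambda>w w'. (w, w') \<in> R \<and> eval R V (\<box> \<phi>) w = eval R V \<phi> w')"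
  define h where "h = (\<lambda>w. g w \<union> (if \<exists>w'. P w w' then {SOME w'. P w w'} else {}))"
  have P: "P w (SOME w'. P w w')" if "P w w'" for w w' using someI[of "P w", OF that] .
  have "eval R V \<phi> w \<in> Luk n" if "w \<in> W" for w
    by (rule eval_in_Luk[OF n _ _ that]) (use R V in auto)
  then have vals: "eval R V \<phi> ` (R `` {w}) \<subseteq> Luk n" for w using R by blast
  show ?case
  proof (rule exI[of _ h], rule witness_funI)
    show "finite (h w)" for w using g(1) by (simp add: h_def)
    show "h w \<subseteq> W" if "w \<in> W" for w
    proof -
      have "(SOME w'. P w w') \<in> W" if "P w w'" for w' using P[OF that] R unfolding P_def by blast
      then show ?thesis using g(2) that by (auto simp: h_def)
    qed
    fix D w assume D: "D \<subseteq> W" "\<forall>w\<in>D. h w \<subseteq> D" and w: "w \<in> D"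
    have "\<forall>w\<in>D. g w \<subseteq> D" using D(2) by (auto simp: h_def)
    then have IH: "eval (R \<inter> D \<times> D) V \<phi> w' = eval R V \<phi> w'" if "w' \<in> D" for w'
      by (rule g(3)[OF D(1) _ that])
    show "eval (R \<inter> D \<times> D) V (\<box> \<phi>) w = eval R V (\<box> \<phi>) w"
    proof (rule eval_box_eqI)
      show "eval R V (\<box> \<phi>) w \<le> 1" by (rule eval_box_cases(2)[OF vals])
      show "eval R V (\<box> \<phi>) w \<le> eval (R \<inter> D \<times> D) V \<phi> w'" if "(w, w') \<in> R \<inter> D \<times> D" for w'
      proof -
        have "w' \<in> D" "(w, w') \<in> R" using that by auto
        then show ?thesis using eval_box_cases(1)[OF vals] IH by simp
      qed
      show "eval R V (\<box> \<phi>) w = 1 \<or>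
          (\<exists>w'. (w, w') \<in> R \<inter> D \<times> D \<and> eval (R \<inter> D \<times> D) V \<phi> w' = eval R V (\<box> \<phi>) w)"
      proof (cases "\<exists>w'. P w w'")
        case True
        let ?w = "SOME w'. P w w'"
        have "P w ?w" using True P by blast
        moreover have "?w \<in> h w" using True by (simp add: h_def)
        then have "?w \<in> D" using D(2) w by blast
        ultimately have "(w, ?w) \<in> R \<inter> D \<times> D" "eval (R \<inter> D \<times> D) V \<phi> ?w = eval R V (\<box> \<phi>) w"
          using w IH by (simp_all add: P_def)
        then show ?thesis by blast
      next
        case False
        then show ?thesis using eval_box_cases(3)[OF vals[of w]] unfolding P_def by blast
      qed
    qed
  qed
qed

lemma countable_submodel:
  assumes "n > 0" "R \<subseteq> W \<times> W" "\<forall>p. \<forall>w\<in>W. V p w \<in> Luk n" "w\<^sub>0 \<in> W"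
  obtains D where "countable D" "D \<subseteq> W" "w\<^sub>0 \<in> D"
    "\<And>w. w \<in> D \<Longrightarrow> eval (R \<inter> D \<times> D) V \<phi> w = eval R V \<phi> w"
proof -
  obtain g where "witness_fun W R V \<phi> g" using witness_fun_exists[OF assms(1-3)] ..
  note g = witness_funD[OF this]
  define G where "G = {(w, w'). w' \<in> g w}"
  define D where "D = G\<^sup>* `` {w\<^sub>0}"
  have "countable (G `` Y)" if "countable Y" for Y
  proof -
    have "G `` Y = (\<Union>w\<in>Y. g w)" by (auto simp: G_def)
    then show ?thesis using that g(1) by (simp add: countable_finite)
  qed
  then have "countable D" unfolding D_def by (rule countable_rtrancl) simp_all
  moreover have "D \<subseteq> W"
  proof
    fix w assume "w \<in> D"
    then have "(w\<^sub>0, w) \<in> G\<^sup>*" by (simp add: D_def)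
    then show "w \<in> W" by induction (use assms(4) g(2) in \<open>auto simp: G_def\<close>)
  qed
  moreover have "w\<^sub>0 \<in> D" by (simp add: D_def)
  moreover have "\<forall>w\<in>D. g w \<subseteq> D"
    unfolding D_def G_def by (auto intro: rtrancl_into_rtrancl)
  ultimately show ?thesis using that g(3) by blast
qed

text \<open>The copy along \<open>f\<close>, meant to be injective on \<open>D\<close>, of the submodel with the set of worlds \<open>D\<close>.\<close>

definition image_rel :: "('a \<Rightarrow> 'w) \<Rightarrow> 'a set \<Rightarrow> ('a \<times> 'a) set \<Rightarrow> ('w \<times> 'w) set" where
  "image_rel f D R = map_prod f f ` (R \<inter> D \<times> D)"

definition image_val :: "('a \<Rightarrow> 'w) \<Rightarrow> 'a set \<Rightarrow> ('v \<Rightarrow> 'a \<Rightarrow> real) \<Rightarrow> 'v \<Rightarrow> 'w \<Rightarrow> real" where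
  "image_val f D V p w = V p (inv_into D f w)"

lemma image_rel_iff:
  assumes "inj_on f D" "u \<in> D" "v \<in> D"
  shows "(f u, f v) \<in> image_rel f D R \<longleftrightarrow> (u, v) \<in> R"
  using assms by (auto simp: image_rel_def inj_on_def)

lemma image_relE:
  assumes "(x, y) \<in> image_rel f D R"
  obtains u v where "x = f u" "y = f v" "u \<in> D" "v \<in> D" "(u, v) \<in> R"
  using assms by (auto simp: image_rel_def)

lemma image_rel_subset: "image_rel f D R \<subseteq> f ` D \<times> f ` D"
  by (auto simp: image_rel_def)

lemma image_val_image: "inj_on f D \<Longrightarrow> u \<in> D \<Longrightarrow> image_val f D V p (f u) = V p u"
  by (simp add: image_val_def)

lemma eval_image:
  assumes "inj_on f D" "w \<in> D"
  shows "eval (image_rel f D R) (image_val f D V) \<phi> (f w) = eval (R \<inter> D \<times> D) V \<phi> w"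
proof -
  have "eval (image_rel f D R) (image_val f D V) \<phi> x =
      eval (R \<inter> D \<times> D) V \<phi> (inv_into D f x)" if "x \<in> f ` D" for x
  proof (rule eval_p_morphism[OF _ _ _ that])
    show "image_rel f D R `` (f ` D) \<subseteq> f ` D" using image_rel_subset[of f D R] by blast
    show "(R \<inter> D \<times> D) `` {inv_into D f x} = inv_into D f ` (image_rel f D R `` {x})"
      if x: "x \<in> f ` D" for x
    proof -
      obtain u where u: "u \<in> D" "x = f u" using x by blast
      have "image_rel f D R `` {x} = f ` ((R \<inter> D \<times> D) `` {u})"
        using assms(1) u by (auto simp: image_rel_def inj_on_def)
      moreover have "inv_into D f ` f ` ((R \<inter> D \<times> D) `` {u}) = (R \<inter> D \<times> D) `` {u}"
        by (rule inv_into_image_cancel[OF assms(1)]) blast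
      ultimately show ?thesis using inv_into_f_f[OF assms(1) u(1)] u(2) by simp
    qed
  qed (simp add: image_val_def)
  then show ?thesis using assms by simp
qed

lemma transported_submodel:
  assumes "infinite (UNIV :: 'w set)"
    and "n > 0" "R \<subseteq> W \<times> W" "\<forall>p. \<forall>w\<in>W. V p w \<in> Luk n" "w\<^sub>0 \<in> W"
  obtains f :: "'a \<Rightarrow> 'w" and D where "inj_on f D" "D \<subseteq> W" "w\<^sub>0 \<in> D"
    "eval (image_rel f D R) (image_val f D V) \<phi> (f w\<^sub>0) = eval R V \<phi> w\<^sub>0"
proof -
  obtain D where D: "countable D" "D \<subseteq> W" "w\<^sub>0 \<in> D"
    "\<And>w. w \<in> D \<Longrightarrow> eval (R \<inter> D \<times> D) V \<phi> w = eval R V \<phi> w"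
    using countable_submodel[OF assms(2-5)] by blast
  obtain g :: "nat \<Rightarrow> 'w" where "inj g" using infinite_countable_subset[OF assms(1)] by blast
  then have "inj_on (g \<circ> to_nat_on D) D"
    using inj_on_to_nat_on[OF D(1)] by (metis comp_inj_on inj_on_subset subset_UNIV)
  then show ?thesis using that[of "g \<circ> to_nat_on D" D] D eval_image by metis
qed

section \<open>Extensions of the minimal logic\<close>

lemma modal_mv_logic_Inter:
  assumes "\<And>L. L \<in> \<L> \<Longrightarrow> modal_mv_logic L"
  shows "modal_mv_logic (\<Inter> \<L>)"
proof -
  note axioms = assms[unfolded modal_mv_logic_def, THEN conjunct2, THEN conjunct2, THEN conjunct2,
      THEN spec, THEN spec, THEN spec]
  show ?thesis
    unfolding modal_mv_logic_def
  proof (intro conjI allI)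
    show "\<phi> \<in> \<Inter> \<L> \<longrightarrow> (\<phi> \<^bold>\<rightarrow> \<psi>) \<in> \<Inter> \<L> \<longrightarrow> \<psi> \<in> \<Inter> \<L>" for \<phi> \<psi> :: "'a form"
      using modal_mv_logic_mp[OF assms, of _ \<phi> \<psi>] by blast
    show "\<phi> \<in> \<Inter> \<L> \<longrightarrow> subst \<sigma> \<phi> \<in> \<Inter> \<L>" for \<phi> and \<sigma> :: "'a \<Rightarrow> 'a form"
      using modal_mv_logic_subst[OF assms, of _ \<phi> \<sigma>] by blast
    show "\<phi> \<in> \<Inter> \<L> \<longrightarrow> \<box> \<phi> \<in> \<Inter> \<L>" for \<phi> :: "'a form"
      using modal_mv_logic_nec[OF assms, of _ \<phi>] by blast
  qed (use axioms in blast)+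
qed

lemma luk_logic_subset_logic_K: "luk_logic n \<subseteq> logic_K n"
  unfolding logic_K_def
proof (rule Inter_greatest, clarify)
  fix L B :: "'a form set" and \<phi> :: "'a form"
  assume L: "modal_mv_logic L" and B: "axiomatic_base n B" "B \<subseteq> L" and "\<phi> \<in> luk_logic n"
  then have "\<phi> \<in> prop_consequences B" by (simp add: axiomatic_base_def)
  then show "\<phi> \<in> L"
  proof induction
    case (base \<phi>)
    with B(2) show ?case by blast
  next
    case (mp \<phi> \<psi>)
    show ?case by (rule modal_mv_logic_mp[OF L mp.IH])
  next
    case (subst \<phi> \<sigma>)
    show ?case by (rule modal_mv_logic_subst[OF L subst.IH])
  qed
qed

lemma luk_modal_logic_K_plus:
  fixes \<Phi> :: "'v form set"
  assumes "infinite (UNIV :: 'v set)" "n > 0"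
  shows "luk_modal_logic n (logic_K_plus n \<Phi>)"
proof
  show "modal_mv_logic (logic_K_plus n \<Phi>)"
    unfolding logic_K_plus_def by (rule modal_mv_logic_Inter) simp
  show "luk_logic n \<subseteq> logic_K_plus n \<Phi>"
    using luk_logic_subset_logic_K unfolding logic_K_plus_def by blast
qed (fact assms)+

lemma axiom_in_logic_K_plus: "\<phi> \<in> \<Phi> \<Longrightarrow> \<phi> \<in> logic_K_plus n \<Phi>"
  unfolding logic_K_plus_def by blast

context luk_modal_logic
begin

lemma acc_subset: "acc \<subseteq> worlds \<times> worlds"
  by (auto simp: acc_def)

lemma image_val_Luk:
  assumes "inj_on f D" "D \<subseteq> worlds" "x \<in> f ` D"
  shows "image_val f D val p x \<in> Luk n"
proof -
  obtain u where "u \<in> D" "x = f u" using assms(3) by blast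
  then show ?thesis using assms(1,2) val_Luk by (auto simp: image_val_image)
qed

lemma refuting_model:
  assumes "infinite (UNIV :: 'w set)" "\<phi> \<notin> L"
  obtains f :: "('v form \<Rightarrow> real) \<Rightarrow> 'w" and D u where "inj_on f D" "D \<subseteq> worlds" "u \<in> D"
    "eval (image_rel f D acc) (image_val f D val) \<phi> (f u) \<noteq> 1"
proof -
  obtain u where u: "u \<in> worlds" "u \<phi> \<noteq> 1" using refuting_world[OF assms(2)] by blast
  obtain f :: "('v form \<Rightarrow> real) \<Rightarrow> 'w" and D where fD: "inj_on f D" "D \<subseteq> worlds" "u \<in> D"
    and eq: "eval (image_rel f D acc) (image_val f D val) \<phi> (f u) = eval acc val \<phi> u"
    using transported_submodel[OF assms(1) n_pos acc_subset _ u(1), of val] val_Luk by blast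
  have "eval (image_rel f D acc) (image_val f D val) \<phi> (f u) \<noteq> 1"
    unfolding eq truth_lemma[OF u(1)] by (rule u(2))
  with fD show ?thesis by (rule that)
qed

text \<open>For completeness it suffices that the class contains all copies of restrictions of the canonical
  frame.\<close>

lemma kripke_complete_wrtI:
  fixes K :: "'w frame set"
  assumes "infinite (UNIV :: 'w set)"
    and frame: "\<And>F. F \<in> K \<Longrightarrow> is_frame F" and sound: "\<And>F \<phi>. F \<in> K \<Longrightarrow> \<phi> \<in> L \<Longrightarrow> valid n F \<phi>"
    and canonical: "\<And>f D. inj_on f D \<Longrightarrow> D \<subseteq> worlds \<Longrightarrow> D \<noteq> {} \<Longrightarrow> (f ` D, image_rel f D acc) \<in> K"
  shows "kripke_complete_wrt n K L"
proof -
  have "\<phi> \<in> L" if valid: "\<forall>F\<in>K. valid n F \<phi>" for \<phi>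
  proof (rule ccontr)
    assume "\<phi> \<notin> L"
    then obtain f :: "('v form \<Rightarrow> real) \<Rightarrow> 'w" and D u where fD: "inj_on f D" "D \<subseteq> worlds" "u \<in> D"
      and no: "eval (image_rel f D acc) (image_val f D val) \<phi> (f u) \<noteq> 1"
      using refuting_model[OF assms(1)] by blast
    have "valid n (f ` D, image_rel f D acc) \<phi>" using valid canonical[OF fD(1,2)] fD(3) by blast
    moreover have "kripke_model n (f ` D) (image_rel f D acc) (image_val f D val)"
      using image_val_Luk[OF fD(1,2)] fD(3) image_rel_subset unfolding kripke_model_def by blast
    ultimately show False using no fD(3) unfolding valid_def true_in_def by blast
  qed
  then show ?thesis using frame sound unfolding kripke_complete_wrt_def by blast
qed

end

section \<open>Boolean successors\<close>

lemma nvalid_excluded_middle: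
  assumes n: "n > 0" and F: "F \<in> boolean_successor_nframes n"
  shows "nvalid n F (\<box> (Var p \<^bold>\<or> \<^bold>\<not> Var p))"
proof -
  obtain W r R where F_eq: "F = (W, r, R)" by (cases F) auto
  have succ: "\<And>u. u \<in> W \<Longrightarrow> R `` {u} \<subseteq> r 1"
    using F unfolding F_eq boolean_successor_nframes_def by blast+
  show ?thesis unfolding F_eq nvalid_iff
  proof (intro allI impI ballI)
    fix V :: "'b \<Rightarrow> 'a \<Rightarrow> real" and u assume V: "nmodel n (W, r, R) V" and u: "u \<in> W"
    have "eval R V (Var p \<^bold>\<or> \<^bold>\<not> Var p) v = 1" if v: "(u, v) \<in> R" for v
    proof -
      have "v \<in> r 1" using v succ[OF u] by blast
      then have "V p v \<in> Luk 1" using V unfolding nmodel_def by auto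
      then have "V p v = 0 \<or> V p v = 1" by (auto simp: Luk_def le_Suc_eq)
      then show ?thesis by (auto simp: eval_Disj)
    qed
    then show "eval R V (\<box> (Var p \<^bold>\<or> \<^bold>\<not> Var p)) u = 1" by (intro eval_box_eqI) auto
  qed
qed

lemma (in luk_modal_logic) boolean_successor:
  assumes "\<box> (Var p \<^bold>\<or> \<^bold>\<not> Var p) \<in> L" "(u, v) \<in> acc"
  shows "v \<phi> = 0 \<or> v \<phi> = 1"
proof -
  note uv = acc_worlds[OF assms(2)]
  have "\<box> (\<phi> \<^bold>\<or> \<^bold>\<not> \<phi>) \<in> L"
    using subst[OF assms(1), of "\<lambda>_. \<phi>"] by (simp add: Disj_def Imp_def)
  then have "v (\<phi> \<^bold>\<or> \<^bold>\<not> \<phi>) = 1" by (intro accD[OF assms(2)] worlds_L[OF uv(1)])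
  then show ?thesis
    by (auto simp: luk_hom_Disj[OF worlds_hom[OF uv(2)]] luk_hom_Neg[OF worlds_hom[OF uv(2)]] max_def
        split: if_splits)
qed

lemma (in luk_modal_logic) complete_boolean_successor_nframes:
  assumes inf_w: "infinite (UNIV :: 'w set)" and n2: "n \<ge> 2"
    and axiom: "\<box> (Var p \<^bold>\<or> \<^bold>\<not> Var p) \<in> L"
    and sound: "\<And>(F :: 'w nframe) \<phi>. F \<in> boolean_successor_nframes n \<Longrightarrow> \<phi> \<in> L \<Longrightarrow> nvalid n F \<phi>"
  shows "nkripke_complete_wrt n (boolean_successor_nframes n :: 'w nframe set) L"
proof -
  have "\<phi> \<in> L" if valid: "\<forall>F\<in>(boolean_successor_nframes n :: 'w nframe set). nvalid n F \<phi>" for \<phi>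
  proof (rule ccontr)
    assume "\<phi> \<notin> L"
    then obtain f :: "('v form \<Rightarrow> real) \<Rightarrow> 'w" and D u where fD: "inj_on f D" "D \<subseteq> worlds" "u \<in> D"
      and no: "eval (image_rel f D acc) (image_val f D val) \<phi> (f u) \<noteq> 1"
      using refuting_model[OF inf_w] by blast
    let ?R = "image_rel f D acc"
    let ?V = "image_val f D val"
    let ?B = "?R `` (f ` D)"
    \<comment> \<open>Every proper divisor of \<open>n\<close> may get the set of all successors, since the values there are Boolean.\<close>
    let ?r = "\<lambda>m. if m = n then f ` D else ?B"
    have B: "?B \<subseteq> f ` D" using image_rel_subset[of f D acc] by blast
    have frame: "is_nframe n (f ` D, ?r, ?R)"
      by (rule is_nframe_two_valued[OF image_rel_subset B]) (use B in blast)
    have "(f ` D, ?r, ?R) \<in> boolean_successor_nframes n"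
      unfolding boolean_successor_nframes_def using frame n2 by auto
    then have nvalid: "nvalid n (f ` D, ?r, ?R) \<phi>" using valid by blast
    have "nmodel n (f ` D, ?r, ?R) ?V"
      unfolding nmodel_def prod.case
    proof (intro conjI allI impI ballI)
      show "kripke_model n (f ` D) ?R ?V"
        using image_val_Luk[OF fD(1,2)] fD(3) image_rel_subset unfolding kripke_model_def by blast
      fix m x p assume m: "m dvd n" and x: "x \<in> ?r m"
      show "?V p x \<in> Luk m"
      proof (cases "m = n")
        case True
        then show ?thesis using image_val_Luk[OF fD(1,2)] x by simp
      next
        case False
        then obtain y where "(y, x) \<in> ?R" using x by auto
        then obtain u v where uv: "x = f v" "v \<in> D" "(u, v) \<in> acc" by (elim image_relE)
        have "?V p x = 0 \<or> ?V p x = 1"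
          using boolean_successor[OF axiom uv(3)] by (simp add: uv image_val_image[OF fD(1)] val_def)
        moreover have "m > 0" using m n_pos by (rule dvd_pos_nat[rotated])
        ultimately show ?thesis using Luk_0 Luk_1 by metis
      qed
    qed
    then show False using nvalid no fD(3) unfolding nvalid_iff by blast
  qed
  then show ?thesis
    using sound unfolding nkripke_complete_wrt_def boolean_successor_nframes_def by blast
qed

text \<open>A successor at which all variables have the value \<open>1 / n\<close> refutes \<open>\<box> (p \<^bold>\<or> \<^bold>\<not> p)\<close>, so the frames of the
  logic have no successors and validate \<open>\<box> p\<close>.\<close>

lemma not_kripke_complete:
  assumes n: "n \<ge> 2" and "\<box> (Var p \<^bold>\<or> \<^bold>\<not> Var p) \<in> L" and "\<box> (Var p) \<notin> L"
  shows "\<not> kripke_complete TYPE('w) n L"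
proof
  assume "kripke_complete TYPE('w) n L"
  then obtain K :: "'w frame set" where frame: "\<And>F. F \<in> K \<Longrightarrow> is_frame F"
    and L: "L = {\<phi>. \<forall>F\<in>K. valid n F \<phi>}"
    unfolding kripke_complete_def kripke_complete_wrt_def by blast
  obtain F where F: "F \<in> K" "\<not> valid n F (\<box> (Var p))" using assms(3) L by blast
  obtain W R where F_eq: "F = (W, R)" by (cases F) auto
  have WR: "W \<noteq> {}" "R \<subseteq> W \<times> W" using frame[OF F(1)] by (auto simp: F_eq is_frame_def)
  have valid: "valid n (W, R) (\<box> (Var p \<^bold>\<or> \<^bold>\<not> Var p))" using assms(2) L F(1) F_eq by blast
  have "(u, v) \<notin> R" for u v
  proof
    assume uv: "(u, v) \<in> R"
    define V where "V = (\<lambda>(_ :: 'a) (_ :: 'w). 1 / real n)"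
    have V_Luk: "V q w \<in> Luk n" for q w
      using n unfolding V_def Luk_def by (auto intro!: exI[of _ 1])
    then have "kripke_model n W R V" using WR unfolding kripke_model_def by blast
    then have "eval R V (\<box> (Var p \<^bold>\<or> \<^bold>\<not> Var p)) u = 1"
      using valid uv WR(2) unfolding valid_def true_in_def by blast
    moreover have "eval R V \<phi> w \<in> Luk n" for \<phi> w
      by (rule eval_in_Luk[where D = UNIV]) (use n V_Luk in auto)
    then have "eval R V (Var p \<^bold>\<or> \<^bold>\<not> Var p) ` (R `` {u}) \<subseteq> Luk n" by blast
    ultimately have "eval R V (Var p \<^bold>\<or> \<^bold>\<not> Var p) v = 1"
      using uv by (simp only: eval_box_eq_1_iff)
    then show False using n by (auto simp: eval_Disj V_def max_def split: if_splits)
  qed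
  then have "valid n (W, R) (\<box> (Var p))" by (auto simp: valid_def true_in_def)
  with F F_eq show False by simp
qed

section \<open>A tabular logic\<close>

text \<open>Of the three worlds \<open>a\<close>, \<open>b\<close>, \<open>c\<close> only the first has a successor, namely \<open>b\<close>, and only \<open>b\<close> is
  forced to be Boolean: \<open>c\<close> represents the worlds without successors, \<open>a\<close> those with one. The worlds
  are meant to be distinct.\<close>

definition fork_nframe :: "nat \<Rightarrow> 'w \<Rightarrow> 'w \<Rightarrow> 'w \<Rightarrow> 'w nframe" where
  "fork_nframe n a b c = ({a, b, c}, (\<lambda>m. if m = n then {a, b, c} else {b}), {(a, b)})"

lemma fork_nframe_boolean_successor:
  assumes "a \<noteq> b" "n \<ge> 2"
  shows "fork_nframe n a b c \<in> boolean_successor_nframes n"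
proof -
  have "is_nframe n (fork_nframe n a b c)"
    unfolding fork_nframe_def by (rule is_nframe_two_valued) (use assms in auto)
  then show ?thesis using assms unfolding boolean_successor_nframes_def fork_nframe_def by auto
qed

lemma fork_nframe_nmodelI:
  assumes n: "n > 0" and "\<And>p w. V p w \<in> Luk n" "\<And>p. V p b = 0 \<or> V p b = 1"
  shows "nmodel n (fork_nframe n a b c) V"
proof -
  have "V p b \<in> Luk m" if "m dvd n" for p m
  proof -
    have "m > 0" using that n by (rule dvd_pos_nat[rotated])
    then show ?thesis using assms(3)[of p] Luk_0 Luk_1 by metis
  qed
  then show ?thesis using assms(2) by (auto simp: nmodel_def fork_nframe_def kripke_model_def)
qed

lemma fork_nframe_axioms:
  assumes n: "n \<ge> 2" and abc: "a \<noteq> b" "a \<noteq> c" "b \<noteq> c"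
  shows "nvalid n (fork_nframe n a b c) (\<box> (\<box> (Var p)))"
    and "nvalid n (fork_nframe n a b c) (\<^bold>\<not> (\<diamond> (Var p) \<^bold>\<and> \<diamond> (\<^bold>\<not> Var p)))"
    and "\<not> nvalid n (fork_nframe n a b c) (\<box> (Var p))"
proof -
  let ?R = "{(a, b)}"
  have dead: "eval ?R V (\<box> \<phi>) w = 1" if "w \<noteq> a" for V w and \<phi> :: "'b form"
    by (rule eval_box_eqI) (use that in auto)
  have step: "eval ?R V (\<box> \<phi>) a = eval ?R V \<phi> b" if "eval ?R V \<phi> b \<le> 1" for V and \<phi> :: "'b form"
    by (rule eval_box_eqI) (use that in auto)
  show "nvalid n (fork_nframe n a b c) (\<box> (\<box> (Var p)))"
    unfolding fork_nframe_def nvalid_iff using dead step abc by (metis order_refl)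
  show "nvalid n (fork_nframe n a b c) (\<^bold>\<not> (\<diamond> (Var p) \<^bold>\<and> \<diamond> (\<^bold>\<not> Var p)))"
    unfolding fork_nframe_def nvalid_iff
  proof (intro allI impI ballI)
    fix V :: "'b \<Rightarrow> 'a \<Rightarrow> real" and w
    assume V: "nmodel n ({a, b, c}, (\<lambda>m. if m = n then {a, b, c} else {b}), ?R) V"
      and w: "w \<in> {a, b, c}"
    have "V p b \<in> Luk 1" using V n unfolding nmodel_def by (auto dest!: spec[of _ 1])
    then have b: "V p b = 0 \<or> V p b = 1" by (auto simp: Luk_def le_Suc_eq)
    show "eval ?R V (\<^bold>\<not> (\<diamond> (Var p) \<^bold>\<and> \<diamond> (\<^bold>\<not> Var p))) w = 1"
    proof (cases "w = a")
      case True
      have "eval ?R V (\<diamond> (Var p)) a = V p b" "eval ?R V (\<diamond> (\<^bold>\<not> Var p)) a = 1 - V p b"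
        using step[of V "\<^bold>\<not> Var p"] step[of V "\<^bold>\<not> \<^bold>\<not> Var p"] b
        by (auto simp: Diamond_def simp del: eval.simps(4))
      then show ?thesis using b True by (auto simp: eval_Conj)
    next
      case False
      then have "eval ?R V (\<diamond> \<phi>) w = 0" for \<phi> :: "'b form"
        using dead[of w V "\<^bold>\<not> \<phi>"] by (simp add: Diamond_def del: eval.simps(4))
      then show ?thesis by (simp add: eval_Conj)
    qed
  qed
  show "\<not> nvalid n (fork_nframe n a b c) (\<box> (Var p))"
  proof
    assume valid: "nvalid n (fork_nframe n a b c) (\<box> (Var p))"
    have "nmodel n (fork_nframe n a b c) (\<lambda>_ _. 0)"
      using n Luk_0 by (intro fork_nframe_nmodelI) auto
    then have "eval ?R (\<lambda>_ _. 0) (\<box> (Var p)) a = 1"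
      using valid unfolding fork_nframe_def nvalid_iff by blast
    moreover have "eval ?R (\<lambda>_ _. 0) (\<box> (Var p)) a = 0" by (rule trans[OF step]) auto
    ultimately show False by simp
  qed
qed

text \<open>By substitution the logic contains \<open>\<box> \<box> \<phi>\<close> for a formula \<open>\<phi>\<close> with the constant value \<open>0\<close>.\<close>

lemma (in luk_modal_logic) dead_end_successor:
  assumes "\<box> (\<box> (Var p)) \<in> L" "(u, v) \<in> acc"
  shows "(v, w) \<notin> acc"
proof
  let ?bot = "\<^bold>\<not> (Var p \<^bold>\<rightarrow> Var p)"
  assume vw: "(v, w) \<in> acc"
  have "\<box> (\<box> ?bot) \<in> L" using subst[OF assms(1), of "\<lambda>_. ?bot"] by simp
  then have "v (\<box> ?bot) = 1" by (rule accD[OF assms(2) worlds_L[OF acc_worlds(1)[OF assms(2)]]])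
  then have "w ?bot = 1" by (rule accD[OF vw])
  then show False
    using worlds_hom[OF acc_worlds(2)[OF vw]] by (simp add: luk_hom_Neg luk_hom_Imp)
qed

text \<open>Distinct successors are Boolean and differ at some \<open>\<phi>\<close>, which makes \<open>\<diamond> \<phi>\<close> and \<open>\<diamond> \<^bold>\<not> \<phi>\<close> both equal to \<open>1\<close>.\<close>

lemma (in luk_modal_logic) unique_successor:
  assumes "\<box> (Var p \<^bold>\<or> \<^bold>\<not> Var p) \<in> L" "\<^bold>\<not> (\<diamond> (Var p) \<^bold>\<and> \<diamond> (\<^bold>\<not> Var p)) \<in> L"
    and acc: "(u, v) \<in> acc" "(u, w) \<in> acc"
  shows "v = w"
proof -
  have no: False if acc: "(u, v) \<in> acc" "(u, w) \<in> acc" and \<phi>: "v \<phi> = 1" "w \<phi> = 0" for v w \<phi>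
  proof -
    note hom = worlds_hom[OF acc_worlds(1)[OF acc(1)]] worlds_hom[OF acc_worlds(2)[OF acc(1)]]
      worlds_hom[OF acc_worlds(2)[OF acc(2)]]
    have "\<^bold>\<not> (\<diamond> \<phi> \<^bold>\<and> \<diamond> (\<^bold>\<not> \<phi>)) \<in> L"
      using subst[OF assms(2), of "\<lambda>_. \<phi>"] by (simp add: Diamond_def Conj_def Disj_def Imp_def)
    then have "u (\<^bold>\<not> (\<diamond> \<phi> \<^bold>\<and> \<diamond> (\<^bold>\<not> \<phi>))) = 1" by (rule worlds_L[OF acc_worlds(1)[OF acc(1)]])
    moreover have "u (\<box> (\<^bold>\<not> \<phi>)) = 0"
      using acc_le[OF acc(1), of "\<^bold>\<not> \<phi>"] \<phi> luk_hom_nonneg[OF hom(1), of "\<box> (\<^bold>\<not> \<phi>)"]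
      by (simp add: luk_hom_Neg[OF hom(2)])
    moreover have "u (\<box> (\<^bold>\<not> \<^bold>\<not> \<phi>)) = 0"
      using acc_le[OF acc(2), of "\<^bold>\<not> \<^bold>\<not> \<phi>"] \<phi> luk_hom_nonneg[OF hom(1), of "\<box> (\<^bold>\<not> \<^bold>\<not> \<phi>)"]
      by (simp add: luk_hom_Neg[OF hom(3)])
    ultimately show False by (simp add: Diamond_def luk_hom_Neg[OF hom(1)] luk_hom_Conj[OF hom(1)])
  qed
  show ?thesis
  proof
    fix \<phi>
    show "v \<phi> = w \<phi>"
      using boolean_successor[OF assms(1) acc(1), of \<phi>] boolean_successor[OF assms(1) acc(2), of \<phi>]
        no[OF acc, of \<phi>] no[OF acc(2,1), of \<phi>] by metis
  qed
qed

lemma (in luk_modal_logic) fork_nframe_complete: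
  assumes ax: "\<box> (Var p \<^bold>\<or> \<^bold>\<not> Var p) \<in> L" "\<box> (\<box> (Var p)) \<in> L"
      "\<^bold>\<not> (\<diamond> (Var p) \<^bold>\<and> \<diamond> (\<^bold>\<not> Var p)) \<in> L"
    and abc: "a \<noteq> b" "a \<noteq> c" "b \<noteq> c" and "nvalid n (fork_nframe n a b c) \<phi>"
  shows "\<phi> \<in> L"
proof (rule ccontr)
  assume "\<phi> \<notin> L"
  then obtain u where u: "u \<in> worlds" "u \<phi> \<noteq> 1" by (rule refuting_world)
  let ?R = "{(a, b)}"
  have valid: "eval ?R V \<phi> w = 1"
    if "\<And>p w. V p w \<in> Luk n" "\<And>p. V p b = 0 \<or> V p b = 1" "w \<in> {a, b, c}" for V w
  proof -
    have "nmodel n (fork_nframe n a b c) V" by (rule fork_nframe_nmodelI[OF n_pos]) (fact that)+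
    then show ?thesis using assms(7) that(3) unfolding fork_nframe_def nvalid_iff by blast
  qed
  show False
  proof (cases "acc `` {u} = {}")
    case True
    define V where "V = (\<lambda>p w. if w = c then val p u else 0)"
    have "eval ?R V \<phi> c = eval acc val \<phi> u"
      by (rule eval_p_morphism[where D = "{c}" and f = "\<lambda>_. u"]) (use True abc in \<open>auto simp: V_def\<close>)
    moreover have "eval ?R V \<phi> c = 1"
      by (rule valid) (use val_Luk[OF u(1)] Luk_0 abc in \<open>auto simp: V_def\<close>)
    ultimately show False using u by (simp add: truth_lemma)
  next
    case False
    then obtain v where uv: "(u, v) \<in> acc" by blast
    have succ_u: "acc `` {u} = {v}" using unique_successor[OF ax(1,3) uv] uv by blast
    have succ_v: "acc `` {v} = {}" using dead_end_successor[OF ax(2) uv] by blast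
    define V where "V = (\<lambda>p w. if w = a then val p u else if w = b then val p v else 0)"
    define f where "f = (\<lambda>w. if w = a then u else v)"
    have "eval ?R V \<phi> a = eval acc val \<phi> (f a)"
    proof (rule eval_p_morphism[where D = "{a, b}"])
      show "acc `` {f w} = f ` (?R `` {w})" if "w \<in> {a, b}" for w
        using that succ_u succ_v abc by (auto simp: f_def)
    qed (use abc in \<open>auto simp: V_def f_def\<close>)
    moreover have "eval ?R V \<phi> a = 1"
    proof (rule valid)
      show "V p w \<in> Luk n" for p w
        using val_Luk[OF u(1)] val_Luk[OF acc_worlds(2)[OF uv]] Luk_0 by (simp add: V_def)
      show "V p b = 0 \<or> V p b = 1" for p
        using boolean_successor[OF ax(1) uv] abc by (simp add: V_def val_def)
    qed simp
    ultimately show False using u by (simp add: f_def truth_lemma)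
  qed
qed

section \<open>Reflexive and transitive frames\<close>

lemma valid_reflexive:
  assumes F: "F \<in> reflexive_frames"
  shows "valid n F (\<box> (Var x) \<^bold>\<rightarrow> Var x)"
proof -
  obtain W R where F_eq: "F = (W, R)" by (cases F) auto
  have WR: "R \<subseteq> W \<times> W" "refl_on W R" using F by (auto simp: F_eq reflexive_frames_def is_frame_def)
  show ?thesis
    unfolding F_eq valid_def prod.case true_in_def
  proof (intro allI impI ballI)
    fix V :: "'b \<Rightarrow> 'a \<Rightarrow> real" and w assume V: "kripke_model n W R V" and w: "w \<in> W"
    have "eval R V (Var x) ` (R `` {w}) \<subseteq> Luk n" using V WR(1) by (auto simp: kripke_model_def)
    then have "eval R V (\<box> (Var x)) w \<le> eval R V (Var x) w"
      by (rule eval_box_cases(1)) (use WR(2) w in \<open>auto dest: refl_onD\<close>)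
    then show "eval R V (\<box> (Var x) \<^bold>\<rightarrow> Var x) w = 1" unfolding eval_Imp_eq_1_iff .
  qed
qed

lemma valid_transitive:
  assumes n: "n > 0" and F: "F \<in> transitive_frames"
  shows "valid n F (\<box> (Var x) \<^bold>\<rightarrow> \<box> (\<box> (Var x)))"
proof -
  obtain W R where F_eq: "F = (W, R)" by (cases F) auto
  have WR: "R \<subseteq> W \<times> W" "trans R" using F by (auto simp: F_eq transitive_frames_def is_frame_def)
  show ?thesis
    unfolding F_eq valid_def prod.case true_in_def
  proof (intro allI impI ballI)
    fix V :: "'b \<Rightarrow> 'a \<Rightarrow> real" and w assume V: "kripke_model n W R V" and w: "w \<in> W"
    have "eval R V \<phi> ` (R `` {w}) \<subseteq> Luk n" for \<phi> w
      using eval_in_Luk[OF n, of R W V] V WR(1) unfolding kripke_model_def by blast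
    note box = eval_box_cases[OF this]
    have "eval R V (\<box> (Var x)) w \<le> eval R V (\<box> (Var x)) v" if v: "(w, v) \<in> R" for v
      using box(3)[of "Var x" v]
    proof
      assume "\<exists>w'. (v, w') \<in> R \<and> eval R V (\<box> (Var x)) v = eval R V (Var x) w'"
      then obtain w' where w': "(v, w') \<in> R" "eval R V (\<box> (Var x)) v = eval R V (Var x) w'" by blast
      have "(w, w') \<in> R" using WR(2) v w'(1) by (rule transD)
      then show ?thesis unfolding w'(2) by (rule box(1))
    qed (metis box(2))
    then have "eval R V (\<box> (Var x)) w \<le> eval R V (\<box> (\<box> (Var x))) w"
      using box(2)[of "Var x" w] box(3)[of "\<box> (Var x)" w] by metis
    then show "eval R V (\<box> (Var x) \<^bold>\<rightarrow> \<box> (\<box> (Var x))) w = 1" unfolding eval_Imp_eq_1_iff .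
  qed
qed

lemma valid_logic_K_plus:
  assumes "n > 0" "is_frame F" "valid n F \<chi>" "\<phi> \<in> logic_K_plus n {\<chi>}"
  shows "valid n F \<phi>"
proof -
  have "nvalid n (free_nframe n F) \<phi>"
    by (rule soundness[OF assms(1) is_nframe_free[OF assms(2)] _ assms(4)])
      (use assms(3) in \<open>simp add: nvalid_free\<close>)
  then show ?thesis by (simp add: nvalid_free)
qed

context luk_modal_logic
begin

lemma acc_reflexive:
  assumes "(\<box> (Var x) \<^bold>\<rightarrow> Var x) \<in> L" "u \<in> worlds"
  shows "(u, u) \<in> acc"
proof -
  have "u \<phi> = 1" if "u (\<box> \<phi>) = 1" for \<phi>
  proof -
    have "(\<box> \<phi> \<^bold>\<rightarrow> \<phi>) \<in> L" using subst[OF assms(1), of "\<lambda>_. \<phi>"] by (simp add: Imp_def)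
    then have "u (\<box> \<phi> \<^bold>\<rightarrow> \<phi>) = 1" by (rule worlds_L[OF assms(2)])
    then show ?thesis
      using that luk_hom_le_1[OF worlds_hom[OF assms(2)], of \<phi>]
      by (simp add: luk_hom_Imp[OF worlds_hom[OF assms(2)]])
  qed
  then show ?thesis using assms(2) by (simp add: acc_def)
qed

lemma acc_transitive:
  assumes "(\<box> (Var x) \<^bold>\<rightarrow> \<box> (\<box> (Var x))) \<in> L" "(u, v) \<in> acc" "(v, w) \<in> acc"
  shows "(u, w) \<in> acc"
proof -
  note u = acc_worlds(1)[OF assms(2)]
  have "w \<phi> = 1" if "u (\<box> \<phi>) = 1" for \<phi>
  proof -
    have "(\<box> \<phi> \<^bold>\<rightarrow> \<box> (\<box> \<phi>)) \<in> L" using subst[OF assms(1), of "\<lambda>_. \<phi>"] by (simp add: Imp_def)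
    then have "u (\<box> \<phi> \<^bold>\<rightarrow> \<box> (\<box> \<phi>)) = 1" by (rule worlds_L[OF u])
    then have "u (\<box> (\<box> \<phi>)) = 1"
      using that luk_hom_le_1[OF worlds_hom[OF u], of "\<box> (\<box> \<phi>)"]
      by (simp add: luk_hom_Imp[OF worlds_hom[OF u]])
    then show ?thesis by (intro accD[OF assms(3)] accD[OF assms(2)])
  qed
  then show ?thesis using u acc_worlds(2)[OF assms(3)] by (simp add: acc_def)
qed

end

text \<open>Both properties of accessibility are inherited by the copies of its restrictions.\<close>

lemma kripke_complete_reflexive:
  fixes x :: 'v
  assumes "infinite (UNIV :: 'v set)" and inf_w: "infinite (UNIV :: 'w set)" and n: "n > 0"
  shows "kripke_complete_wrt n (reflexive_frames :: 'w frame set)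
    (logic_K_plus n {\<box> (Var x) \<^bold>\<rightarrow> Var x})"
proof -
  let ?ax = "\<box> (Var x) \<^bold>\<rightarrow> Var x"
  interpret luk_modal_logic n "logic_K_plus n {?ax}" by (rule luk_modal_logic_K_plus[OF assms(1) n])
  have ax: "?ax \<in> logic_K_plus n {?ax}" by (rule axiom_in_logic_K_plus) simp
  have frame: "is_frame F" if "F \<in> reflexive_frames" for F :: "'w frame"
    using that by (auto simp: reflexive_frames_def)
  show ?thesis
  proof (rule kripke_complete_wrtI[OF inf_w frame])
    show "valid n F \<phi>" if "F \<in> reflexive_frames" "\<phi> \<in> logic_K_plus n {?ax}" for F :: "'w frame" and \<phi>
      by (rule valid_logic_K_plus[OF n frame[OF that(1)] valid_reflexive[OF that(1)] that(2)])
    fix f :: "('v form \<Rightarrow> real) \<Rightarrow> 'w" and D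
    assume D: "inj_on f D" "D \<subseteq> worlds" "D \<noteq> {}"
    have "refl_on (f ` D) (image_rel f D acc)"
      using D acc_reflexive[OF ax] image_rel_subset[of f D acc] image_rel_iff[OF D(1)]
      by (auto intro!: refl_onI)
    then show "(f ` D, image_rel f D acc) \<in> reflexive_frames"
      by (simp add: reflexive_frames_def is_frame_def image_rel_subset D(3))
  qed
qed

lemma kripke_complete_transitive:
  fixes x :: 'v
  assumes "infinite (UNIV :: 'v set)" and inf_w: "infinite (UNIV :: 'w set)" and n: "n > 0"
  shows "kripke_complete_wrt n (transitive_frames :: 'w frame set)
    (logic_K_plus n {\<box> (Var x) \<^bold>\<rightarrow> \<box> (\<box> (Var x))})"
proof -
  let ?ax = "\<box> (Var x) \<^bold>\<rightarrow> \<box> (\<box> (Var x))"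
  interpret luk_modal_logic n "logic_K_plus n {?ax}" by (rule luk_modal_logic_K_plus[OF assms(1) n])
  have ax: "?ax \<in> logic_K_plus n {?ax}" by (rule axiom_in_logic_K_plus) simp
  have frame: "is_frame F" if "F \<in> transitive_frames" for F :: "'w frame"
    using that by (auto simp: transitive_frames_def)
  show ?thesis
  proof (rule kripke_complete_wrtI[OF inf_w frame])
    show "valid n F \<phi>" if "F \<in> transitive_frames" "\<phi> \<in> logic_K_plus n {?ax}" for F :: "'w frame" and \<phi>
      by (rule valid_logic_K_plus[OF n frame[OF that(1)] valid_transitive[OF n that(1)] that(2)])
    fix f :: "('v form \<Rightarrow> real) \<Rightarrow> 'w" and D
    assume D: "inj_on f D" "D \<subseteq> worlds" "D \<noteq> {}"
    have "trans (image_rel f D acc)"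
    proof (rule transI)
      fix a b c assume "(a, b) \<in> image_rel f D acc" "(b, c) \<in> image_rel f D acc"
      then obtain u v v' w where *: "a = f u" "b = f v" "u \<in> D" "v \<in> D" "(u, v) \<in> acc"
        "b = f v'" "c = f w" "v' \<in> D" "w \<in> D" "(v', w) \<in> acc"
        by (elim image_relE)
      then have "v = v'" using D(1) by (auto dest: inj_onD)
      with * have "(u, w) \<in> acc" using acc_transitive[OF ax] by blast
      with * show "(a, c) \<in> image_rel f D acc" using image_rel_iff[OF D(1)] by simp
    qed
    then show "(f ` D, image_rel f D acc) \<in> transitive_frames"
      by (simp add: transitive_frames_def is_frame_def image_rel_subset D(3))
  qed
qed

section \<open>The four logics\<close>

theorem proposition6p6:
  fixes n :: nat and p x :: 'v
  assumes "infinite (UNIV :: 'v set)" and "infinite (UNIV :: 'w set)" and "n \<ge> 2"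
  shows
    "nkripke_complete_wrt n (boolean_successor_nframes n :: 'w nframe set)
       (logic_K_plus n {\<box> (Var p \<^bold>\<or> \<^bold>\<not> Var p)}) \<and>
     \<not> kripke_complete TYPE('w) n (logic_K_plus n {\<box> (Var p \<^bold>\<or> \<^bold>\<not> Var p)}) \<and>
     ntabular TYPE('w) n
       (logic_K_plus n {\<box> (Var p \<^bold>\<or> \<^bold>\<not> Var p), \<box> (\<box> (Var p)),
          \<^bold>\<not> (\<diamond> (Var p) \<^bold>\<and> \<diamond> (\<^bold>\<not> Var p))}) \<and>
     \<not> kripke_complete TYPE('w) n
       (logic_K_plus n {\<box> (Var p \<^bold>\<or> \<^bold>\<not> Var p), \<box> (\<box> (Var p)),
          \<^bold>\<not> (\<diamond> (Var p) \<^bold>\<and> \<diamond> (\<^bold>\<not> Var p))}) \<and>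
     kripke_complete_wrt n (reflexive_frames :: 'w frame set)
       (logic_K_plus n {\<box> (Var x) \<^bold>\<rightarrow> Var x}) \<and>
     kripke_complete_wrt n (transitive_frames :: 'w frame set)
       (logic_K_plus n {\<box> (Var x) \<^bold>\<rightarrow> \<box> (\<box> (Var x))})"
proof -
  note inf_v = assms(1) and inf_w = assms(2) and n2 = assms(3)
  have n: "n > 0" using n2 by simp
  let ?em = "\<box> (Var p \<^bold>\<or> \<^bold>\<not> Var p)"
  let ?A = "{?em, \<box> (\<box> (Var p)), \<^bold>\<not> (\<diamond> (Var p) \<^bold>\<and> \<diamond> (\<^bold>\<not> Var p))}"
  let ?L1 = "logic_K_plus n {?em}"
  let ?L2 = "logic_K_plus n ?A"
  obtain W :: "'w set" where "card W = 3" using infinite_arbitrarily_large[OF inf_w] by metis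
  then obtain a b c :: 'w where abc: "a \<noteq> b" "a \<noteq> c" "b \<noteq> c" by (auto simp: card_3_iff)
  let ?F = "fork_nframe n a b c"
  have F: "?F \<in> boolean_successor_nframes n" by (rule fork_nframe_boolean_successor[OF abc(1) n2])
  have frame: "is_nframe n G" if "G \<in> boolean_successor_nframes n" for G :: "'w nframe"
    using that unfolding boolean_successor_nframes_def by blast
  have sound1: "nvalid n G \<phi>" if "G \<in> boolean_successor_nframes n" "\<phi> \<in> ?L1" for G :: "'w nframe" and \<phi>
    by (rule soundness[OF n frame[OF that(1)] _ that(2)])
      (use nvalid_excluded_middle[OF n that(1)] in simp)
  have sound2: "nvalid n ?F \<phi>" if "\<phi> \<in> ?L2" for \<phi>
    by (rule soundness[OF n frame[OF F] _ that])
      (use nvalid_excluded_middle[OF n F] fork_nframe_axioms(1,2)[OF n2 abc] in auto)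
  have L1: "?em \<in> ?L1" by (rule axiom_in_logic_K_plus) simp
  have L2: "?em \<in> ?L2" "\<box> (\<box> (Var p)) \<in> ?L2" "\<^bold>\<not> (\<diamond> (Var p) \<^bold>\<and> \<diamond> (\<^bold>\<not> Var p)) \<in> ?L2"
    by (rule axiom_in_logic_K_plus; simp)+
  have box_p: "\<box> (Var p) \<notin> ?L1" "\<box> (Var p) \<notin> ?L2"
    using sound1[OF F, of "\<box> (Var p)"] sound2[of "\<box> (Var p)"] fork_nframe_axioms(3)[OF n2 abc, of p]
    by fast+
  interpret L1: luk_modal_logic n ?L1 by (rule luk_modal_logic_K_plus[OF inf_v n])
  interpret L2: luk_modal_logic n ?L2 by (rule luk_modal_logic_K_plus[OF inf_v n])
  have "?L2 = {\<phi>. nvalid n ?F \<phi>}"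
    by (intro set_eqI iffI CollectI) (erule sound2, erule CollectE, rule L2.fork_nframe_complete[OF L2 abc])
  moreover have "finite (fst ?F)" by (simp add: fork_nframe_def)
  ultimately have "ntabular TYPE('w) n ?L2" using frame[OF F] unfolding ntabular_def by blast
  moreover have "nkripke_complete_wrt n (boolean_successor_nframes n :: 'w nframe set) ?L1"
    by (rule L1.complete_boolean_successor_nframes[OF inf_w n2 L1 sound1])
  ultimately show ?thesis
    using not_kripke_complete[OF n2 L1 box_p(1)] not_kripke_complete[OF n2 L2(1) box_p(2)]
      kripke_complete_reflexive[OF inf_v inf_w n] kripke_complete_transitive[OF inf_v inf_w n]
    by (intro conjI)
qed

end
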